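(* Let $(\mathbf X,d)$ be a complete length space and $\Omega\subset\mathbf X$ an open set. Let $H:\Omega\times\mathbb R\times[0,\infty)\to\mathbb R$ be continuous and satisfy: (1) for any $x_0\in\Omega$ and $\rho_0\in\mathbb R$ there exist $\delta>0$ small and a modulus of continuity $\omega$ such that $$|H(x_1,\rho_1,p)-H(x_2,\rho_2,p)|\le\omega\big(d(x_1,x_2)+|\rho_1-\rho_2|\big)$$ for all $x_1,x_2\in B_\delta(x_0)$, $\rho_1,\rho_2\in[\rho_0-\delta,\rho_0+\delta]$ and $p\ge0$; (2) for any $x_0\in\Omega$ and $\rho_0\in\mathbb R$ there exist $\delta>0$ and $\lambda_0>0$ such that $p\mapsto H(x,\rho,p)-\lambda_0p$ is increasing (on $[0,\infty)$) for every $(x,\rho)\in B_\delta(x_0)\times[\rho_0-\delta,\rho_0+\delta]$; (3) for every $R>0$, $\inf_{(x,\rho)\in\Omega\times[-R,R]}H(x,\rho,p)\to\infty$ as $p\to\infty$. Then $u$ is a Monge solution of $H(x,u,|\nabla u|)=0$ in $\Omega$ if and only if $u$ is a locally uniformly continuous s-solution of $H(x,u,|\nabla u|)=0$ in $\Omega$. In addition, such $u$ is locally Lipschitz in $\Omega$.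
   Context: "Locally" means in a sufficiently small open ball around each point of $\Omega$; $B_\delta(x)$ is the open $d$-ball. A modulus of continuity is a continuous nondecreasing function $\omega:[0,\infty)\to[0,\infty)$ with $\omega(0)=0$. $\mathrm{Lip}_{loc}(\Omega)$ is the set of locally Lipschitz functions on $\Omega$. Slopes: $|\nabla u|(x)=\limsup_{y\to x}\frac{|u(y)-u(x)|}{d(x,y)}$, $|\nabla^+u|(x)=\limsup_{y\to x}\frac{\max\{u(y)-u(x),0\}}{d(x,y)}$, $|\nabla^-u|(x)=\limsup_{y\to x}\frac{\max\{u(x)-u(y),0\}}{d(x,y)}$. Monge solution of $H(x,u,|\nabla u|)=0$: $u\in\mathrm{Lip}_{loc}(\Omega)$ with $H(x,u(x),|\nabla^-u|(x))=0$ for every $x\in\Omega$. s-solutions. $\overline{\mathcal C}(\Omega)$ (resp. $\underline{\mathcal C}(\Omega)$) is the set of $\psi\in\mathrm{Lip}_{loc}(\Omega)$ with $|\nabla^+\psi|=|\nabla\psi|$ (resp. $|\nabla^-\psi|=|\nabla\psi|$) in $\Omega$ and $|\nabla\psi|$ continuous in $\Omega$; $|\nabla\psi|^*(x)=\limsup_{y\to x}|\nabla\psi|(y)$. For $a\ge0$ put $H_a(x,\rho,p)=\inf\{H(x,\rho,q):q\ge0,|q-p|\le a\}$ and $H^a(x,\rho,p)=\sup\{H(x,\rho,q):q\ge0,|q-p|\le a\}$. An upper semicontinuous $u:\Omega\to\mathbb R$ is an s-subsolution if $H_{|\nabla\psi_2|^*(x)}(x,u(x),|\nabla\psi_1|(x))\le0$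 whenever $\psi_1\in\underline{\mathcal C}(\Omega)$, $\psi_2\in\mathrm{Lip}_{loc}(\Omega)$ and $u-\psi_1-\psi_2$ has a local maximum at $x\in\Omega$. A lower semicontinuous $u:\Omega\to\mathbb R$ is an s-supersolution if $H^{|\nabla\psi_2|^*(x)}(x,u(x),|\nabla\psi_1|(x))\ge0$ whenever $\psi_1\in\overline{\mathcal C}(\Omega)$, $\psi_2\in\mathrm{Lip}_{loc}(\Omega)$ and $u-\psi_1-\psi_2$ has a local minimum at $x\in\Omega$. A function $u\in C(\Omega)$ is an s-solution if it is both. *)

theory Defs
  imports "HOL-Analysis.Analysis"
begin

text \<open>
  Functions on an open set \<open>\<Omega>\<close> are total functions on the ambient space; every notion below that is
  evaluated at a point of \<open>\<Omega>\<close> depends only on the values near that point, so the values outside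
  \<open>\<Omega>\<close> are irrelevant.
\<close>

definition curve_length :: "(real \<Rightarrow> 'a::metric_space) \<Rightarrow> ennreal" where
  "curve_length g =
     (SUP (n, t) \<in> {(n::nat, t::nat \<Rightarrow> real). mono_on {..n} t \<and> t ` {..n} \<subseteq> {0..1}}.
        \<Sum>i<n. ennreal (dist (g (t i)) (g (t (Suc i)))))"

text \<open>The infimum of the empty set in \<^typ>\<open>ennreal\<close> is infinite, so in a length space any two points
  are joined by a rectifiable curve.\<close>

definition length_space :: "'a::metric_space itself \<Rightarrow> bool" where
  "length_space _ \<longleftrightarrow>
     (\<forall>x y::'a. ennreal (dist x y) =
        (INF g \<in> {g. path g \<and> pathstart g = x \<and> pathfinish g = y}. curve_length g))"

definition modulus_of_continuity :: "(real \<Rightarrow> real) \<Rightarrow> bool" where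
  "modulus_of_continuity \<omega> \<longleftrightarrow>
     continuous_on {0..} \<omega> \<and> mono_on {0..} \<omega> \<and> (\<forall>t\<ge>0. 0 \<le> \<omega> t) \<and> \<omega> 0 = 0"

definition Lip_loc :: "'a::metric_space set \<Rightarrow> ('a \<Rightarrow> real) set" where
  "Lip_loc \<Omega> = {u. \<forall>x\<in>\<Omega>. \<exists>\<delta>>0. ball x \<delta> \<subseteq> \<Omega> \<and> (\<exists>L. L-lipschitz_on (ball x \<delta>) u)}"

definition locally_uniformly_continuous_on :: "'a::metric_space set \<Rightarrow> ('a \<Rightarrow> real) \<Rightarrow> bool" where
  "locally_uniformly_continuous_on \<Omega> u \<longleftrightarrow>
     (\<forall>x\<in>\<Omega>. \<exists>\<delta>>0. ball x \<delta> \<subseteq> \<Omega> \<and> uniformly_continuous_on (ball x \<delta>) u)"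

definition usc_on :: "'a::topological_space set \<Rightarrow> ('a \<Rightarrow> real) \<Rightarrow> bool" where
  "usc_on \<Omega> u \<longleftrightarrow> (\<forall>x\<in>\<Omega>. \<forall>a. u x < a \<longrightarrow> (\<forall>\<^sub>F y in at x within \<Omega>. u y < a))"

definition lsc_on :: "'a::topological_space set \<Rightarrow> ('a \<Rightarrow> real) \<Rightarrow> bool" where
  "lsc_on \<Omega> u \<longleftrightarrow> (\<forall>x\<in>\<Omega>. \<forall>a. a < u x \<longrightarrow> (\<forall>\<^sub>F y in at x within \<Omega>. a < u y))"

text \<open>The slopes take values in \<open>[0,\<infinity>]\<close>. They are finite at the points where the function is locally
  Lipschitz, and \<^const>\<open>enn2real\<close> is only applied in that situation. At an isolated point (which in
  a length space means that the space is a singleton) the slopes are 0.\<close>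

definition slope :: "('a::metric_space \<Rightarrow> real) \<Rightarrow> 'a \<Rightarrow> ennreal" where
  "slope u x = Limsup (at x) (\<lambda>y. ennreal (\<bar>u y - u x\<bar> / dist x y))"

definition super_slope :: "('a::metric_space \<Rightarrow> real) \<Rightarrow> 'a \<Rightarrow> ennreal" where
  "super_slope u x = Limsup (at x) (\<lambda>y. ennreal (max (u y - u x) 0 / dist x y))"

definition sub_slope :: "('a::metric_space \<Rightarrow> real) \<Rightarrow> 'a \<Rightarrow> ennreal" where
  "sub_slope u x = Limsup (at x) (\<lambda>y. ennreal (max (u x - u y) 0 / dist x y))"

text \<open>The upper semicontinuous envelope of the slope; here, unlike in the slopes themselves, the
  limit superior includes the point \<open>x\<close>. For locally Lipschitz functions on a length space,
  excluding \<open>x\<close> would give the same value.\<close>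

definition slope_env :: "('a::metric_space \<Rightarrow> real) \<Rightarrow> 'a \<Rightarrow> ennreal" where
  "slope_env u x = Limsup (nhds x) (slope u)"

definition C_over :: "'a::metric_space set \<Rightarrow> ('a \<Rightarrow> real) set" where
  "C_over \<Omega> = {\<psi> \<in> Lip_loc \<Omega>. (\<forall>x\<in>\<Omega>. super_slope \<psi> x = slope \<psi> x) \<and> continuous_on \<Omega> (slope \<psi>)}"

definition C_under :: "'a::metric_space set \<Rightarrow> ('a \<Rightarrow> real) set" where
  "C_under \<Omega> = {\<psi> \<in> Lip_loc \<Omega>. (\<forall>x\<in>\<Omega>. sub_slope \<psi> x = slope \<psi> x) \<and> continuous_on \<Omega> (slope \<psi>)}"

definition H_lower :: "('a \<Rightarrow> real \<Rightarrow> real \<Rightarrow> real) \<Rightarrow> real \<Rightarrow> 'a \<Rightarrow> real \<Rightarrow> real \<Rightarrow> real" where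
  "H_lower H a x \<rho> p = (INF q \<in> {q. 0 \<le> q \<and> \<bar>q - p\<bar> \<le> a}. H x \<rho> q)"

definition H_upper :: "('a \<Rightarrow> real \<Rightarrow> real \<Rightarrow> real) \<Rightarrow> real \<Rightarrow> 'a \<Rightarrow> real \<Rightarrow> real \<Rightarrow> real" where
  "H_upper H a x \<rho> p = (SUP q \<in> {q. 0 \<le> q \<and> \<bar>q - p\<bar> \<le> a}. H x \<rho> q)"

definition local_max_at :: "('a::topological_space \<Rightarrow> real) \<Rightarrow> 'a \<Rightarrow> bool" where
  "local_max_at f x \<longleftrightarrow> (\<forall>\<^sub>F y in nhds x. f y \<le> f x)"

definition local_min_at :: "('a::topological_space \<Rightarrow> real) \<Rightarrow> 'a \<Rightarrow> bool" where
  "local_min_at f x \<longleftrightarrow> (\<forall>\<^sub>F y in nhds x. f x \<le> f y)"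

definition Monge_solution ::
  "('a::metric_space \<Rightarrow> real \<Rightarrow> real \<Rightarrow> real) \<Rightarrow> 'a set \<Rightarrow> ('a \<Rightarrow> real) \<Rightarrow> bool" where
  "Monge_solution H \<Omega> u \<longleftrightarrow>
     u \<in> Lip_loc \<Omega> \<and> (\<forall>x\<in>\<Omega>. H x (u x) (enn2real (sub_slope u x)) = 0)"

definition s_subsolution ::
  "('a::metric_space \<Rightarrow> real \<Rightarrow> real \<Rightarrow> real) \<Rightarrow> 'a set \<Rightarrow> ('a \<Rightarrow> real) \<Rightarrow> bool" where
  "s_subsolution H \<Omega> u \<longleftrightarrow>
     usc_on \<Omega> u \<and>
     (\<forall>\<psi>\<^sub>1\<in>C_under \<Omega>. \<forall>\<psi>\<^sub>2\<in>Lip_loc \<Omega>. \<forall>x\<in>\<Omega>.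
        local_max_at (\<lambda>y. u y - \<psi>\<^sub>1 y - \<psi>\<^sub>2 y) x \<longrightarrow>
        H_lower H (enn2real (slope_env \<psi>\<^sub>2 x)) x (u x) (enn2real (slope \<psi>\<^sub>1 x)) \<le> 0)"

definition s_supersolution ::
  "('a::metric_space \<Rightarrow> real \<Rightarrow> real \<Rightarrow> real) \<Rightarrow> 'a set \<Rightarrow> ('a \<Rightarrow> real) \<Rightarrow> bool" where
  "s_supersolution H \<Omega> u \<longleftrightarrow>
     lsc_on \<Omega> u \<and>
     (\<forall>\<psi>\<^sub>1\<in>C_over \<Omega>. \<forall>\<psi>\<^sub>2\<in>Lip_loc \<Omega>. \<forall>x\<in>\<Omega>.
        local_min_at (\<lambda>y. u y - \<psi>\<^sub>1 y - \<psi>\<^sub>2 y) x \<longrightarrow>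
        H_upper H (enn2real (slope_env \<psi>\<^sub>2 x)) x (u x) (enn2real (slope \<psi>\<^sub>1 x)) \<ge> 0)"

definition s_solution ::
  "('a::metric_space \<Rightarrow> real \<Rightarrow> real \<Rightarrow> real) \<Rightarrow> 'a set \<Rightarrow> ('a \<Rightarrow> real) \<Rightarrow> bool" where
  "s_solution H \<Omega> u \<longleftrightarrow>
     continuous_on \<Omega> u \<and> s_subsolution H \<Omega> u \<and> s_supersolution H \<Omega> u"

end

theory Submission
  imports Defs
begin

text \<open>
  If \<open>u - \<psi>\<^sub>1 - \<psi>\<^sub>2\<close> has a local maximum at \<open>x\<close>, the subslope of \<open>\<psi>\<^sub>1\<close> at \<open>x\<close> exceeds that of \<open>u\<close> by
  at most the slope of \<open>\<psi>\<^sub>2\<close>, and symmetrically at a local minimum. As \<open>H\<close> increases in \<open>p\<close>, the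
  relaxed Hamiltonians are \<open>H x \<rho> (max (p - a) 0)\<close> and \<open>H x \<rho> (p + a)\<close>, so Monge solutions are
  s-solutions.

  For the converse, in a length space \<open>\<phi> (d(\<cdot>, x))\<close> with \<open>\<phi>\<close> increasing and \<open>C\<^sup>1\<close>, \<open>\<phi>' 0 = 0\<close>, has slope and
  subslope \<open>\<phi>' (d(\<cdot>, x))\<close>. Ekeland's principle produces maxima of \<open>u - \<phi> (d(\<cdot>, x)) - \<eta> d(\<cdot>, z)\<close>, the last
  term being absorbed as \<open>\<psi>\<^sub>2\<close>. If \<open>H y (u y) K > 0\<close> for \<open>y\<close> near \<open>x\<^sub>0\<close> and \<open>\<phi>\<close> approximates a cone of slope
  \<open>M > K\<close>, such maxima must be close to the vertex \<open>x\<close>; letting the smoothing tend to 0 gives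
  \<open>u y \<le> u x + M d(x, y) + A d(x, y)\<^sup>2\<close> uniformly in \<open>x\<close>, hence local Lipschitz continuity and the
  upper bound on the subslope. If the subslope at \<open>x\<^sub>0\<close> were below some \<open>k\<close> with \<open>H x\<^sub>0 (u x\<^sub>0) k < 0\<close>, then
  \<open>u\<close> plus a smoothed cone of slope less than \<open>k\<close> would have an approximate local minimum near \<open>x\<^sub>0\<close>,
  contradicting the supersolution property.
\<close>

subsection \<open>Slopes\<close>

lemma sub_slope_leI:
  fixes u :: "'a::metric_space \<Rightarrow> real"
  assumes "c \<ge> 0" "\<forall>\<^sub>F y in at x. u x - u y \<le> c * dist x y"
  shows "sub_slope u x \<le> ennreal c"
  unfolding sub_slope_def
proof (rule Limsup_bounded)
  have "\<forall>\<^sub>F y in at x. y \<noteq> x" by (simp add: eventually_at_filter)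
  with assms(2) show "\<forall>\<^sub>F y in at x. ennreal (max (u x - u y) 0 / dist x y) \<le> ennreal c"
    by eventually_elim (use assms(1) in \<open>auto intro!: ennreal_leI simp: divide_le_eq\<close>)
qed

lemma sub_slope_lessD:
  fixes u :: "'a::metric_space \<Rightarrow> real"
  assumes "sub_slope u x < ennreal c"
  shows "\<forall>\<^sub>F y in at x. u x - u y \<le> c * dist x y"
proof -
  have "\<forall>\<^sub>F y in at x. y \<noteq> x" by (simp add: eventually_at_filter)
  moreover have "\<forall>\<^sub>F y in at x. ennreal (max (u x - u y) 0 / dist x y) < ennreal c"
    using assms unfolding sub_slope_def by (rule Limsup_lessD)
  ultimately show ?thesis
    by eventually_elim (auto simp: ennreal_less_iff divide_less_eq)
qed

lemma slope_leI:
  fixes u :: "'a::metric_space \<Rightarrow> real"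
  assumes "c \<ge> 0" "\<forall>\<^sub>F y in at x. \<bar>u y - u x\<bar> \<le> c * dist x y"
  shows "slope u x \<le> ennreal c"
  unfolding slope_def
proof (rule Limsup_bounded)
  have "\<forall>\<^sub>F y in at x. y \<noteq> x" by (simp add: eventually_at_filter)
  with assms(2) show "\<forall>\<^sub>F y in at x. ennreal (\<bar>u y - u x\<bar> / dist x y) \<le> ennreal c"
    by eventually_elim (use assms(1) in \<open>auto intro!: ennreal_leI simp: divide_le_eq\<close>)
qed

lemma slope_lessD:
  fixes u :: "'a::metric_space \<Rightarrow> real"
  assumes "slope u x < ennreal c"
  shows "\<forall>\<^sub>F y in at x. \<bar>u y - u x\<bar> \<le> c * dist x y"
proof -
  have "\<forall>\<^sub>F y in at x. y \<noteq> x" by (simp add: eventually_at_filter)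
  moreover have "\<forall>\<^sub>F y in at x. ennreal (\<bar>u y - u x\<bar> / dist x y) < ennreal c"
    using assms unfolding slope_def by (rule Limsup_lessD)
  ultimately show ?thesis
    by eventually_elim (auto simp: ennreal_less_iff divide_less_eq)
qed

lemma sub_slope_le_slope: "sub_slope u x \<le> slope u x"
  unfolding sub_slope_def slope_def
  by (intro Limsup_mono always_eventually allI ennreal_leI divide_right_mono) auto

lemma slope_uminus: "slope (\<lambda>y. - u y) x = slope u x"
  unfolding slope_def by (simp add: abs_minus_commute)

lemma super_slope_uminus: "super_slope (\<lambda>y. - u y) x = sub_slope u x"
  unfolding super_slope_def sub_slope_def by simp

section \<open>Finiteness of slopes and continuity of locally Lipschitz functions\<close>

lemma lipschitz_on_slope_le:
  assumes "L-lipschitz_on S u" "open S" "x \<in> S"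
  shows "slope u x \<le> ennreal L"
proof (rule slope_leI)
  show "L \<ge> 0" using assms(1) by (rule lipschitz_on_nonneg)
  have "\<forall>\<^sub>F y in at x. y \<in> S"
    using assms(2,3) by (meson eventually_at_topological)
  then show "\<forall>\<^sub>F y in at x. \<bar>u y - u x\<bar> \<le> L * dist x y"
    by eventually_elim (use lipschitz_onD[OF assms(1) _ assms(3)] in \<open>auto simp: dist_real_def dist_commute\<close>)
qed

lemma lipschitz_on_slope_env_le:
  assumes "L-lipschitz_on S u" "open S" "x \<in> S"
  shows "slope_env u x \<le> ennreal L"
  unfolding slope_env_def
proof (rule Limsup_bounded)
  have "\<forall>\<^sub>F y in nhds x. y \<in> S"
    using assms(2,3) by (rule eventually_nhds_in_open)
  then show "\<forall>\<^sub>F y in nhds x. slope u y \<le> ennreal L"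
    by eventually_elim (rule lipschitz_on_slope_le[OF assms(1,2)])
qed

text \<open>The limit superior over \<open>nhds x\<close> includes \<open>x\<close> itself, so every
  neighbourhood contributes \<open>slope u x\<close> to the supremum.\<close>

lemma slope_le_slope_env: "slope u x \<le> slope_env u x"
  unfolding slope_env_def Limsup_def
  by (intro INF_greatest SUP_upper) (auto dest: eventually_nhds_x_imp_x)

lemma Lip_locE:
  assumes "u \<in> Lip_loc \<Omega>" "x \<in> \<Omega>"
  obtains \<delta> L where "\<delta> > 0" "ball x \<delta> \<subseteq> \<Omega>" "L-lipschitz_on (ball x \<delta>) u"
  using assms unfolding Lip_loc_def by blast

lemma Lip_loc_slope_env_finite:
  assumes "u \<in> Lip_loc \<Omega>" "x \<in> \<Omega>"
  shows "slope_env u x < top"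
proof -
  obtain \<delta> L where *: "\<delta> > 0" "L-lipschitz_on (ball x \<delta>) u"
    using Lip_locE[OF assms] by metis
  show ?thesis
    using lipschitz_on_slope_env_le[OF *(2), of x] *(1) by (auto intro: le_less_trans[OF _ ennreal_less_top])
qed

lemma Lip_loc_slope_finite:
  assumes "u \<in> Lip_loc \<Omega>" "x \<in> \<Omega>"
  shows "slope u x < top"
  using Lip_loc_slope_env_finite[OF assms] slope_le_slope_env le_less_trans by blast

lemma Lip_loc_sub_slope_finite:
  assumes "u \<in> Lip_loc \<Omega>" "x \<in> \<Omega>"
  shows "sub_slope u x < top"
  using Lip_loc_slope_finite[OF assms] sub_slope_le_slope le_less_trans by blast

lemma enn2real_slope_le_slope_env:
  assumes "u \<in> Lip_loc \<Omega>" "x \<in> \<Omega>"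
  shows "enn2real (slope u x) \<le> enn2real (slope_env u x)"
  using Lip_loc_slope_env_finite[OF assms] slope_le_slope_env by (intro enn2real_mono) auto

lemma Lip_loc_imp_locally_uniformly_continuous_on:
  assumes "u \<in> Lip_loc \<Omega>"
  shows "locally_uniformly_continuous_on \<Omega> u"
  using assms lipschitz_on_uniformly_continuous
  unfolding Lip_loc_def locally_uniformly_continuous_on_def by blast

lemma locally_uniformly_continuous_on_imp_continuous_on:
  assumes "locally_uniformly_continuous_on \<Omega> u"
  shows "continuous_on \<Omega> u"
proof (rule continuous_at_imp_continuous_on, rule ballI)
  fix x assume "x \<in> \<Omega>"
  then obtain \<delta> where "\<delta> > 0" "uniformly_continuous_on (ball x \<delta>) u"
    using assms unfolding locally_uniformly_continuous_on_def by blast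
  then show "isCont u x"
    using continuous_on_interior[of "ball x \<delta>" u x] uniformly_continuous_imp_continuous by auto
qed

subsection \<open>Ekeland's variational principle\<close>

text \<open>Move repeatedly to an almost best point among those that improve \<open>f\<close> by at
  least \<open>\<eta>\<close> times the distance travelled. Since \<open>f\<close> is bounded above,
  the moves form a Cauchy sequence, and completeness of \<open>E\<close> provides the limit
  \<open>z\<close>.\<close>

lemma ekeland:
  fixes f :: "'a::metric_space \<Rightarrow> real"
  assumes E: "complete E" and f: "continuous_on E f" and bdd: "\<And>y. y \<in> E \<Longrightarrow> f y \<le> B"
    and a: "a \<in> E" and \<eta>: "\<eta> > 0"
  obtains z where "z \<in> E" "f a \<le> f z" "\<And>y. y \<in> E \<Longrightarrow> f y \<le> f z + \<eta> * dist y z"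
proof -
  define S where "S x = {y \<in> E. f x + \<eta> * dist x y \<le> f y}" for x
  have step: "\<exists>y. y \<in> E \<and> y \<in> S x \<and> (\<forall>w\<in>S x. f w \<le> f y + (1/2)^n)" if "x \<in> E" for x and n :: nat
  proof -
    have ne: "f ` S x \<noteq> {}" using that by (auto simp: S_def intro!: exI[of _ x])
    have bd: "bdd_above (f ` S x)" using bdd by (auto simp: S_def bdd_above_def)
    have "Sup (f ` S x) - (1/2)^n < Sup (f ` S x)" by simp
    then obtain y where y: "y \<in> S x" "Sup (f ` S x) - (1/2)^n < f y"
      using less_cSup_iff[OF ne bd] by auto
    have "f w \<le> f y + (1/2)^n" if "w \<in> S x" for w
      using cSup_upper[OF imageI[OF that] bd] y(2) by linarith
    with y(1) show ?thesis by (auto simp: S_def)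
  qed
  \<comment> \<open>Each point maximises \<open>f\<close> over the improvement set of its
    predecessor up to \<open>(1/2)^n\<close>; the error tends to 0, which makes the limit
    unimprovable.\<close>
  obtain X where X0: "X 0 = a" and XE: "\<And>n. X n \<in> E"
    and XS: "\<And>n. X (Suc n) \<in> S (X n)" and XW: "\<And>n w. w \<in> S (X n) \<Longrightarrow> f w \<le> f (X (Suc n)) + (1/2)^n"
    using dependent_nat_choice[of "\<lambda>n x. x \<in> E \<and> (n = 0 \<longrightarrow> x = a)"
        "\<lambda>n x y. y \<in> S x \<and> (\<forall>w\<in>S x. f w \<le> f y + (1/2)^n)"] a step by (metis nat.distinct(1))
  have inc: "f (X m) + \<eta> * dist (X m) (X n) \<le> f (X n)" if "m \<le> n" for m n
    using that
  proof (induction rule: dec_induct)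
    case (step n)
    have "f (X n) + \<eta> * dist (X n) (X (Suc n)) \<le> f (X (Suc n))"
      using XS[of n] by (simp add: S_def)
    moreover have "\<eta> * dist (X m) (X (Suc n)) \<le> \<eta> * (dist (X m) (X n) + dist (X n) (X (Suc n)))"
      using \<eta> by (intro mult_left_mono dist_triangle) auto
    ultimately show ?case using step.IH by (simp add: algebra_simps)
  qed simp
  have "incseq (\<lambda>n. f (X n))"
    using inc \<eta> by (intro monoI) (smt (verit) mult_nonneg_nonneg zero_le_dist)
  then obtain l where l: "(\<lambda>n. f (X n)) \<longlonglongrightarrow> l"
    using incseq_convergent[of "\<lambda>n. f (X n)" B] bdd XE by metis
  have Cau: "Cauchy X"
  proof (rule metric_CauchyI)
    fix e :: real assume "e > 0"
    then have "e * \<eta> > 0" using \<eta> by simp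
    then obtain N where N: "\<And>m n. m \<ge> N \<Longrightarrow> n \<ge> N \<Longrightarrow> dist (f (X m)) (f (X n)) < e * \<eta>"
      using metric_CauchyD[OF LIMSEQ_imp_Cauchy[OF l]] by metis
    have *: "dist (X m) (X n) < e" if "m \<ge> N" "m \<le> n" for m n
    proof -
      have "\<eta> * dist (X m) (X n) < e * \<eta>"
        using inc[OF that(2)] N[of m n] that by (simp add: dist_real_def)
      then show ?thesis using \<eta> by (simp add: mult.commute)
    qed
    show "\<exists>M. \<forall>m\<ge>M. \<forall>n\<ge>M. dist (X m) (X n) < e"
      using * by (metis dist_commute nle_le)
  qed
  obtain z where z: "z \<in> E" "X \<longlonglongrightarrow> z"
    using E Cau XE unfolding complete_def by blast
  have fz: "(\<lambda>n. f (X n)) \<longlonglongrightarrow> f z"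
    using f z XE by (simp add: continuous_on_sequentially o_def)
  have le: "f (X m) + \<eta> * dist (X m) z \<le> f z" for m
  proof (rule LIMSEQ_le[OF _ fz])
    show "(\<lambda>n. f (X m) + \<eta> * dist (X m) (X n)) \<longlonglongrightarrow> f (X m) + \<eta> * dist (X m) z"
      by (intro tendsto_intros z)
    show "\<exists>N. \<forall>n\<ge>N. f (X m) + \<eta> * dist (X m) (X n) \<le> f (X n)" using inc by blast
  qed
  have "f y \<le> f z + \<eta> * dist y z" if y: "y \<in> E" for y
  proof (rule ccontr)
    assume n: "\<not> ?thesis"
    \<comment> \<open>A point violating the bound at \<open>z\<close> improves on every
      \<open>X n\<close> too, so \<open>XW\<close> bounds \<open>f y\<close> by
      \<open>f (X (Suc n)) + (1/2)^n\<close>, and in the limit by \<open>f z\<close>.\<close>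
    have "y \<in> S (X n)" for n
    proof -
      have "\<eta> * dist (X n) y \<le> \<eta> * (dist (X n) z + dist y z)"
        using \<eta> by (intro mult_left_mono) (auto intro: dist_triangle2)
      then show ?thesis using n le[of n] y by (auto simp: S_def algebra_simps)
    qed
    then have "f y \<le> f (X (Suc n)) + (1/2)^n" for n using XW by blast
    moreover have "(\<lambda>n. f (X (Suc n)) + (1/2)^n) \<longlonglongrightarrow> f z + 0"
      by (intro tendsto_add LIMSEQ_Suc fz LIMSEQ_power_zero) auto
    ultimately have "f y \<le> f z" using LIMSEQ_le_const by fastforce
    moreover have "\<eta> * dist y z \<ge> 0" using \<eta> by simp
    ultimately show False using n by linarith
  qed
  moreover have "f a \<le> f z" using le[of 0] X0 \<eta> by (smt (verit) mult_nonneg_nonneg zero_le_dist)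
  ultimately show ?thesis using that z by blast
qed

subsection \<open>Radial test functions\<close>

text \<open>The subdivision 0, \<open>t\<close>, 1 is admissible in the supremum that defines the
  length.\<close>

lemma curve_length_ge:
  fixes g :: "real \<Rightarrow> 'a::metric_space"
  assumes "0 \<le> t" "t \<le> 1"
  shows "ennreal (dist (g 0) (g t) + dist (g t) (g 1)) \<le> curve_length g"
proof -
  define s where "s = (\<lambda>i::nat. if i = 0 then 0 else if i = 1 then t else (1::real))"
  have "(2, s) \<in> {(n::nat, t::nat \<Rightarrow> real). mono_on {..n} t \<and> t ` {..n} \<subseteq> {0..1}}"
    using assms by (auto simp: s_def mono_on_def)
  from SUP_upper[OF this, of "\<lambda>(n, t). \<Sum>i<n. ennreal (dist (g (t i)) (g (t (Suc i))))"]
  show ?thesis unfolding curve_length_def by (simp add: s_def numeral_2_eq_2 lessThan_Suc ennreal_plus add.commute)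
qed

text \<open>Substitute for a point on a geodesic: on a curve from \<open>y\<close> to
  \<open>x\<close> of length below \<open>dist y x + e\<close>, the intermediate value theorem finds
  a point at distance \<open>s\<close> from \<open>y\<close>, and the length leaves at most the
  stated distance to \<open>x\<close>.\<close>

lemma length_space_intermediate:
  fixes x y :: "'a::metric_space"
  assumes "length_space TYPE('a)" "0 \<le> s" "s \<le> dist y x" "e > 0"
  obtains w where "dist y w = s" "dist w x \<le> dist y x - s + e"
proof -
  have "(INF g \<in> {g. path g \<and> pathstart g = y \<and> pathfinish g = x}. curve_length g) = ennreal (dist y x)"
    using assms(1) unfolding length_space_def by simp
  also have "\<dots> < ennreal (dist y x + e)" using assms(4) by (simp add: ennreal_lessI add_nonneg_pos)
  finally obtain g where g: "path g" "pathstart g = y" "pathfinish g = x" "curve_length g < ennreal (dist y x + e)"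
    by (auto simp: INF_less_iff)
  have "continuous_on {0..1} (\<lambda>t. dist y (g t))"
    using g(1) unfolding path_def by (intro continuous_intros)
  then obtain t where t: "0 \<le> t" "t \<le> 1" "dist y (g t) = s"
    using IVT'[of "\<lambda>t. dist y (g t)" 0 s 1] g assms by (auto simp: pathstart_def pathfinish_def)
  have "ennreal (dist y (g t) + dist (g t) x) < ennreal (dist y x + e)"
    using curve_length_ge[OF t(1,2), of g] g by (auto simp: pathstart_def pathfinish_def)
  then have "dist y (g t) + dist (g t) x < dist y x + e"
    by (simp add: ennreal_less_iff flip: ennreal_plus)
  with t(3) that[of "g t"] show ?thesis by simp
qed

text \<open>The distance to \<open>x\<close> is 1-Lipschitz, and near \<open>dist y x\<close> the
  difference quotients of \<open>\<phi>\<close> are at most \<open>p + e\<close> in absolute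
  value.\<close>

lemma radial_slope_le:
  fixes x y :: "'a::metric_space"
  assumes d: "(\<phi> has_real_derivative p) (at (dist y x))" and p: "p \<ge> 0"
  shows "slope (\<lambda>w. \<phi> (dist w x)) y \<le> ennreal p"
proof (rule ennreal_le_epsilon)
  fix e :: real assume e: "e > 0"
  have "((\<lambda>r. (\<phi> r - \<phi> (dist y x)) / (r - dist y x)) \<longlongrightarrow> p) (at (dist y x))"
    using d by (simp add: has_field_derivative_iff)
  from tendstoD[OF this e] obtain \<delta> where "\<delta> > 0" and
    \<delta>: "\<And>r. r \<noteq> dist y x \<Longrightarrow> dist r (dist y x) < \<delta> \<Longrightarrow> dist ((\<phi> r - \<phi> (dist y x)) / (r - dist y x)) p < e"
    unfolding eventually_at by blast
  have "\<bar>\<phi> (dist w x) - \<phi> (dist y x)\<bar> \<le> (p + e) * dist y w" if "dist w y < \<delta>" for w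
  proof (cases "dist w x = dist y x")
    case False
    have l: "\<bar>dist w x - dist y x\<bar> \<le> dist y w"
      by (metis abs_dist_diff_le dist_commute)
    have "dist ((\<phi> (dist w x) - \<phi> (dist y x)) / (dist w x - dist y x)) p < e"
      using \<delta>[OF False] l that by (simp add: dist_real_def dist_commute)
    then have "\<bar>(\<phi> (dist w x) - \<phi> (dist y x)) / (dist w x - dist y x)\<bar> \<le> p + e"
      using p unfolding dist_real_def by linarith
    then have "\<bar>\<phi> (dist w x) - \<phi> (dist y x)\<bar> \<le> (p + e) * \<bar>dist w x - dist y x\<bar>"
      using False by (simp add: abs_divide divide_le_eq)
    also have "\<dots> \<le> (p + e) * dist y w" using l p e by (intro mult_left_mono) auto
    finally show ?thesis .
  qed (use p e in simp)
  then have "slope (\<lambda>w. \<phi> (dist w x)) y \<le> ennreal (p + e)"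
    using p e \<open>\<delta> > 0\<close> by (intro slope_leI) (auto simp: eventually_at)
  then show "slope (\<lambda>w. \<phi> (dist w x)) y \<le> ennreal p + ennreal e"
    using p e by simp
qed

text \<open>Moving from \<open>y\<close> towards \<open>x\<close> along an almost shortest curve
  lowers the distance to \<open>x\<close> at nearly unit speed, so \<open>\<phi>\<close> of the
  distance drops at a rate arbitrarily close to \<open>p\<close>.\<close>

lemma radial_sub_slope_ge:
  fixes x y :: "'a::metric_space"
  assumes len: "length_space TYPE('a)" and xy: "x \<noteq> y"
    and d: "(\<phi> has_real_derivative p) (at (dist y x))"
    and mono: "mono_on {0..} \<phi>"
  shows "ennreal p \<le> sub_slope (\<lambda>w. \<phi> (dist w x)) y"
proof (rule ccontr)
  assume "\<not> ?thesis"
  then have "sub_slope (\<lambda>w. \<phi> (dist w x)) y < ennreal p" by simp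
  then obtain c where c: "sub_slope (\<lambda>w. \<phi> (dist w x)) y < ennreal c" "0 \<le> c" "c < p"
    by (metis dense ennreal_cases ennreal_less_iff ennreal_less_top order_less_imp_not_less top.not_eq_extremum)
  define r where "r = dist y x"
  have r: "r > 0" using xy by (simp add: r_def)
  define c' where "c' = (c + p) / 2"
  have c': "c < c'" "c' < p" using c by (auto simp: c'_def)
  \<comment> \<open>\<open>t\<close> is the midpoint of \<open>c / c'\<close> and 1, a speed below 1
    at which the drop \<open>c' * t\<close> per unit length still exceeds \<open>c\<close>.\<close>
  define t where "t = (c + c') / (2 * c')"
  have t: "0 < t" "t < 1" "c' * t > c" using c c' by (auto simp: t_def field_simps)
  obtain \<delta> where \<delta>: "\<delta> > 0" "\<And>w. w \<noteq> y \<Longrightarrow> dist w y < \<delta> \<Longrightarrow> \<phi> (dist y x) - \<phi> (dist w x) \<le> c * dist y w"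
    using sub_slope_lessD[OF c(1)] unfolding eventually_at by auto
  have "((\<lambda>q. (\<phi> q - \<phi> r) / (q - r)) \<longlongrightarrow> p) (at r)"
    using d by (simp add: has_field_derivative_iff r_def)
  from order_tendstoD(1)[OF this c'(2)] obtain \<delta>' where \<delta>': "\<delta>' > 0"
    "\<And>q. q \<noteq> r \<Longrightarrow> dist q r < \<delta>' \<Longrightarrow> c' < (\<phi> q - \<phi> r) / (q - r)"
    unfolding eventually_at by auto
  define s where "s = min (min \<delta> \<delta>') r / 2"
  have s: "s > 0" "s < \<delta>" "s < \<delta>'" "s < r" using \<delta> \<delta>' r by (auto simp: s_def)
  have ts: "0 < t * s" "t * s < s" using t s by auto
  \<comment> \<open>The slack \<open>(1 - t) * s\<close> is chosen so that \<open>w\<close> is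
    within \<open>r - t * s\<close> of \<open>x\<close>.\<close>
  obtain w where w: "dist y w = s" "dist w x \<le> r - s + (1 - t) * s"
    using length_space_intermediate[OF len, of s y x "(1 - t) * s"] s t by (auto simp: r_def)
  have "c' < (\<phi> (r - t * s) - \<phi> r) / (r - t * s - r)"
    by (intro \<delta>'(2)) (use ts s in \<open>unfold dist_real_def, linarith+\<close>)
  then have "c' * (t * s) < \<phi> r - \<phi> (r - t * s)"
    using ts by (simp add: field_simps)
  moreover have "\<phi> (dist w x) \<le> \<phi> (r - t * s)"
  proof (rule mono_onD[OF mono])
    show "r - t * s \<in> {0..}" using ts(2) s(4) by simp
    show "dist w x \<le> r - t * s" using w(2) by (simp add: algebra_simps)
  qed simp
  moreover have "\<phi> r - \<phi> (dist w x) \<le> c * s"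
    using \<delta>(2)[of w] w s by (auto simp: r_def dist_commute)
  moreover have "c * s < c' * (t * s)" using t s by (simp add: mult.assoc[symmetric])
  ultimately show False by linarith
qed

lemma radial_Lip_loc:
  fixes x :: "'a::metric_space"
  assumes "open \<Omega>" and d: "\<And>r. (\<phi> has_real_derivative \<phi>' r) (at r)" and c: "continuous_on UNIV \<phi>'"
  shows "(\<lambda>w. \<phi> (dist w x)) \<in> Lip_loc \<Omega>"
  unfolding Lip_loc_def
proof (intro CollectI ballI)
  fix y assume "y \<in> \<Omega>"
  then obtain \<delta> where \<delta>: "\<delta> > 0" "ball y \<delta> \<subseteq> \<Omega>" using \<open>open \<Omega>\<close> openE by blast
  define R where "R = dist y x + \<delta>"
  have "compact (\<phi>' ` {0..R})"
    by (intro compact_continuous_image continuous_on_subset[OF c]) auto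
  then obtain L where L: "L > 0" "\<And>r. r \<in> {0..R} \<Longrightarrow> \<bar>\<phi>' r\<bar> \<le> L"
    using compact_imp_bounded bounded_pos by (metis (no_types, lifting) image_eqI real_norm_def)
  have Lip: "\<bar>\<phi> r - \<phi> s\<bar> \<le> L * \<bar>r - s\<bar>" if "r \<in> {0..R}" "s \<in> {0..R}" for r s
    using field_differentiable_bound[of "{0..R}" \<phi> \<phi>' L s r] L that has_field_derivative_at_within[OF d]
    by (auto simp: abs_minus_commute)
  have "L-lipschitz_on (ball y \<delta>) (\<lambda>w. \<phi> (dist w x))"
  proof (rule lipschitz_onI)
    fix v w assume vw: "v \<in> ball y \<delta>" "w \<in> ball y \<delta>"
    have "dist v x \<le> R" "dist w x \<le> R"
      using vw dist_triangle[of v x y] dist_triangle[of w x y] by (auto simp: R_def dist_commute)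
    then have "\<bar>\<phi> (dist v x) - \<phi> (dist w x)\<bar> \<le> L * \<bar>dist v x - dist w x\<bar>" by (intro Lip) auto
    also have "\<dots> \<le> L * dist v w"
      using L(1) abs_dist_diff_le[of v x w] by (intro mult_left_mono) (auto simp: dist_commute)
    finally show "dist (\<phi> (dist v x)) (\<phi> (dist w x)) \<le> L * dist v w" by (simp add: dist_real_def)
  qed (use L in simp)
  with \<delta> show "\<exists>\<delta>>0. ball y \<delta> \<subseteq> \<Omega> \<and> (\<exists>L. L-lipschitz_on (ball y \<delta>) (\<lambda>w. \<phi> (dist w x)))" by blast
qed

text \<open>Away from \<open>x\<close> the two one-sided bounds meet. At \<open>x\<close> the
  function has a minimum and its subslope is 0, so the formula there relies on
  \<open>\<phi>' 0 = 0\<close>.\<close>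

lemma radial_slopes:
  fixes x y :: "'a::metric_space"
  assumes len: "length_space TYPE('a)"
    and d: "\<And>r. (\<phi> has_real_derivative \<phi>' r) (at r)"
    and nonneg: "\<forall>r\<ge>0. \<phi>' r \<ge> 0" and zero: "\<phi>' 0 = 0"
  shows "slope (\<lambda>w. \<phi> (dist w x)) y = ennreal (\<phi>' (dist y x))"
    and "sub_slope (\<lambda>w. \<phi> (dist w x)) y = ennreal (\<phi>' (dist y x))"
proof -
  have "mono_on {0..} \<phi>"
  proof (rule mono_onI)
    fix r s :: real assume rs: "r \<in> {0..}" "r \<le> s"
    show "\<phi> r \<le> \<phi> s"
      by (rule DERIV_nonneg_imp_nondecreasing[OF rs(2)]) (use rs d nonneg in force)
  qed
  then have "ennreal (\<phi>' (dist y x)) \<le> sub_slope (\<lambda>w. \<phi> (dist w x)) y"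
    using radial_sub_slope_ge[OF len _ d] zero by (cases "x = y") auto
  moreover have "slope (\<lambda>w. \<phi> (dist w x)) y \<le> ennreal (\<phi>' (dist y x))"
    using nonneg by (intro radial_slope_le d) auto
  ultimately show "slope (\<lambda>w. \<phi> (dist w x)) y = ennreal (\<phi>' (dist y x))"
    and "sub_slope (\<lambda>w. \<phi> (dist w x)) y = ennreal (\<phi>' (dist y x))"
    using sub_slope_le_slope[of "\<lambda>w. \<phi> (dist w x)" y] by auto
qed

text \<open>The explicit slope formula gives continuity of the slope; a change of sign exchanges
  subslope and superslope, hence the two test classes.\<close>

lemma radial_test_functions:
  fixes x :: "'a::metric_space"
  assumes len: "length_space TYPE('a)" and "open \<Omega>"
    and d: "\<And>r. (\<phi> has_real_derivative \<phi>' r) (at r)" and c: "continuous_on UNIV \<phi>'"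
    and nonneg: "\<forall>r\<ge>0. \<phi>' r \<ge> 0" and zero: "\<phi>' 0 = 0"
  shows "(\<lambda>w. \<phi> (dist w x)) \<in> C_under \<Omega>" and "(\<lambda>w. - \<phi> (dist w x)) \<in> C_over \<Omega>"
proof -
  note s = radial_slopes[OF len d nonneg zero]
  have "continuous_on \<Omega> (\<lambda>y. ennreal (\<phi>' (dist y x)))"
    by (intro continuous_on_ennreal continuous_on_compose2[OF c] continuous_intros) auto
  then have cont: "continuous_on \<Omega> (slope (\<lambda>w. \<phi> (dist w x)))"
    by (simp add: s(1) cong: continuous_on_cong)
  have Lip: "(\<lambda>w. \<phi> (dist w x)) \<in> Lip_loc \<Omega>" by (rule radial_Lip_loc[OF assms(2) d c])
  have nLip: "(\<lambda>w. - \<phi> (dist w x)) \<in> Lip_loc \<Omega>"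
    using radial_Lip_loc[OF assms(2), of "\<lambda>r. - \<phi> r" "\<lambda>r. - \<phi>' r"] d c
    by (auto intro!: DERIV_minus continuous_intros)
  show "(\<lambda>w. \<phi> (dist w x)) \<in> C_under \<Omega>"
    using Lip cont s by (simp add: C_under_def)
  show "(\<lambda>w. - \<phi> (dist w x)) \<in> C_over \<Omega>"
    using nLip cont s by (simp add: C_over_def slope_uminus[abs_def] super_slope_uminus)
qed

subsection \<open>Monge solutions are s-solutions\<close>

text \<open>By monotonicity the infimum is attained at the smallest admissible \<open>q\<close>,
  which is \<open>p - a\<close> cut off at 0.\<close>

lemma H_lower_eq:
  assumes "mono_on {0..} (H x \<rho>)" "0 \<le> a" "0 \<le> p"
  shows "H_lower H a x \<rho> p = H x \<rho> (max (p - a) 0)"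
  unfolding H_lower_def
proof (rule cInf_eq_minimum)
  show "H x \<rho> (max (p - a) 0) \<in> H x \<rho> ` {q. 0 \<le> q \<and> \<bar>q - p\<bar> \<le> a}"
    using assms(2,3) by (intro imageI) auto
  show "H x \<rho> (max (p - a) 0) \<le> y" if "y \<in> H x \<rho> ` {q. 0 \<le> q \<and> \<bar>q - p\<bar> \<le> a}" for y
    using that by (auto intro!: mono_onD[OF assms(1)])
qed

lemma H_upper_eq:
  assumes "mono_on {0..} (H x \<rho>)" "0 \<le> a" "0 \<le> p"
  shows "H_upper H a x \<rho> p = H x \<rho> (p + a)"
  unfolding H_upper_def
proof (rule cSup_eq_maximum)
  show "H x \<rho> (p + a) \<in> H x \<rho> ` {q. 0 \<le> q \<and> \<bar>q - p\<bar> \<le> a}"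
    using assms(2,3) by (intro imageI) auto
  show "y \<le> H x \<rho> (p + a)" if "y \<in> H x \<rho> ` {q. 0 \<le> q \<and> \<bar>q - p\<bar> \<le> a}" for y
    using that by (auto intro!: mono_onD[OF assms(1)])
qed

text \<open>Serves both test inequalities: for a local maximum of
  \<open>u - \<psi>\<^sub>1 - \<psi>\<^sub>2\<close> it is applied to the pair
  \<open>\<psi>\<^sub>1\<close>, \<open>u\<close>, for a local minimum to the pair \<open>u\<close>,
  \<open>\<psi>\<^sub>1\<close>; the increment of \<open>\<psi>\<^sub>2\<close> enters in absolute
  value.\<close>

lemma sub_slope_add_le:
  assumes ev: "\<forall>\<^sub>F w in nhds x. u x - u w \<le> (v x - v w) + \<bar>\<psi> w - \<psi> x\<bar>"
    and fin: "sub_slope v x < top" "slope \<psi> x < top"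
  shows "sub_slope u x \<le> ennreal (enn2real (sub_slope v x) + enn2real (slope \<psi> x))"
proof (rule ennreal_le_epsilon)
  fix e :: real assume e: "e > 0"
  define p q where "p = enn2real (sub_slope v x)" "q = enn2real (slope \<psi> x)"
  have "p \<ge> 0" "q \<ge> 0" by (auto simp: p_q_def)
  have "sub_slope v x < ennreal (p + e/2)" "slope \<psi> x < ennreal (q + e/2)"
    using e fin by (auto simp: p_q_def enn2real_less_iff[symmetric] less_top)
  then have "\<forall>\<^sub>F w in at x. v x - v w \<le> (p + e/2) * dist x w"
    and "\<forall>\<^sub>F w in at x. \<bar>\<psi> w - \<psi> x\<bar> \<le> (q + e/2) * dist x w"
    by (auto dest: sub_slope_lessD slope_lessD)
  moreover have "\<forall>\<^sub>F w in at x. u x - u w \<le> (v x - v w) + \<bar>\<psi> w - \<psi> x\<bar>"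
    using ev by (simp add: eventually_at_filter eventually_mono)
  ultimately have "\<forall>\<^sub>F w in at x. u x - u w \<le> (p + q + e) * dist x w"
    by eventually_elim (simp add: algebra_simps)
  then have "sub_slope u x \<le> ennreal (p + q + e)"
    using \<open>p \<ge> 0\<close> \<open>q \<ge> 0\<close> e by (intro sub_slope_leI) auto
  then show "sub_slope u x \<le> ennreal (enn2real (sub_slope v x) + enn2real (slope \<psi> x)) + ennreal e"
    using \<open>p \<ge> 0\<close> \<open>q \<ge> 0\<close> e by (simp add: p_q_def flip: ennreal_plus)
qed

lemma Monge_solution_imp_s_solution:
  assumes mono: "\<And>x. x \<in> \<Omega> \<Longrightarrow> mono_on {0..} (H x (u x))" and u: "Monge_solution H \<Omega> u"
  shows "s_solution H \<Omega> u"
proof -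
  have L: "u \<in> Lip_loc \<Omega>" and eq: "\<And>x. x \<in> \<Omega> \<Longrightarrow> H x (u x) (enn2real (sub_slope u x)) = 0"
    using u by (auto simp: Monge_solution_def)
  have c: "continuous_on \<Omega> u"
    using L Lip_loc_imp_locally_uniformly_continuous_on locally_uniformly_continuous_on_imp_continuous_on by blast
  then have t: "(u \<longlongrightarrow> u x) (at x within \<Omega>)" if "x \<in> \<Omega>" for x
    using that by (simp add: continuous_on_def)
  have "usc_on \<Omega> u" "lsc_on \<Omega> u"
    unfolding usc_on_def lsc_on_def using t by (auto dest: order_tendstoD)
  moreover have "H_lower H (enn2real (slope_env \<psi>\<^sub>2 x)) x (u x) (enn2real (slope \<psi>\<^sub>1 x)) \<le> 0"
    if \<psi>: "\<psi>\<^sub>1 \<in> C_under \<Omega>" "\<psi>\<^sub>2 \<in> Lip_loc \<Omega>" "x \<in> \<Omega>" "local_max_at (\<lambda>y. u y - \<psi>\<^sub>1 y - \<psi>\<^sub>2 y) x"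
    for \<psi>\<^sub>1 \<psi>\<^sub>2 x
  proof -
    have "sub_slope \<psi>\<^sub>1 x \<le> ennreal (enn2real (sub_slope u x) + enn2real (slope \<psi>\<^sub>2 x))"
      using \<psi>(4) unfolding local_max_at_def
      by (intro sub_slope_add_le Lip_loc_sub_slope_finite[OF L] Lip_loc_slope_finite[OF \<psi>(2)] \<psi>(3))
        (auto elim!: eventually_mono)
    \<comment> \<open>Membership in \<open>C_under\<close> turns the bound on the subslope of
      \<open>\<psi>\<^sub>1\<close> into one on its slope.\<close>
    then have "enn2real (slope \<psi>\<^sub>1 x) \<le> enn2real (sub_slope u x) + enn2real (slope \<psi>\<^sub>2 x)"
      using \<psi>(1,3) by (intro enn2real_leI) (auto simp: C_under_def)
    then have "max (enn2real (slope \<psi>\<^sub>1 x) - enn2real (slope_env \<psi>\<^sub>2 x)) 0 \<le> enn2real (sub_slope u x)"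
      using enn2real_slope_le_slope_env[OF \<psi>(2,3)] by auto
    then have "H x (u x) (max (enn2real (slope \<psi>\<^sub>1 x) - enn2real (slope_env \<psi>\<^sub>2 x)) 0)
        \<le> H x (u x) (enn2real (sub_slope u x))"
      by (intro mono_onD[OF mono[OF \<psi>(3)]]) auto
    also note eq[OF \<psi>(3)]
    finally have "H x (u x) (max (enn2real (slope \<psi>\<^sub>1 x) - enn2real (slope_env \<psi>\<^sub>2 x)) 0) \<le> 0" .
    then show ?thesis by (simp add: H_lower_eq[where H=H, OF mono[OF \<psi>(3)]])
  qed
  moreover have "H_upper H (enn2real (slope_env \<psi>\<^sub>2 x)) x (u x) (enn2real (slope \<psi>\<^sub>1 x)) \<ge> 0"
    if \<psi>: "\<psi>\<^sub>1 \<in> C_over \<Omega>" "\<psi>\<^sub>2 \<in> Lip_loc \<Omega>" "x \<in> \<Omega>" "local_min_at (\<lambda>y. u y - \<psi>\<^sub>1 y - \<psi>\<^sub>2 y) x"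
    for \<psi>\<^sub>1 \<psi>\<^sub>2 x
  proof -
    have L1: "\<psi>\<^sub>1 \<in> Lip_loc \<Omega>" using \<psi>(1) by (simp add: C_over_def)
    have "sub_slope u x \<le> ennreal (enn2real (sub_slope \<psi>\<^sub>1 x) + enn2real (slope \<psi>\<^sub>2 x))"
      using \<psi>(4) unfolding local_min_at_def
      by (intro sub_slope_add_le Lip_loc_sub_slope_finite[OF L1] Lip_loc_slope_finite[OF \<psi>(2)] \<psi>(3))
        (auto elim!: eventually_mono)
    then have "enn2real (sub_slope u x) \<le> enn2real (sub_slope \<psi>\<^sub>1 x) + enn2real (slope \<psi>\<^sub>2 x)"
      by (intro enn2real_leI) auto
    moreover have "enn2real (sub_slope \<psi>\<^sub>1 x) \<le> enn2real (slope \<psi>\<^sub>1 x)"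
      using Lip_loc_slope_finite[OF L1 \<psi>(3)] by (intro enn2real_mono sub_slope_le_slope)
    ultimately have "enn2real (sub_slope u x) \<le> enn2real (slope \<psi>\<^sub>1 x) + enn2real (slope_env \<psi>\<^sub>2 x)"
      using enn2real_slope_le_slope_env[OF \<psi>(2,3)] by auto
    then have "H x (u x) (enn2real (sub_slope u x))
        \<le> H x (u x) (enn2real (slope \<psi>\<^sub>1 x) + enn2real (slope_env \<psi>\<^sub>2 x))"
      by (intro mono_onD[OF mono[OF \<psi>(3)]]) auto
    with eq[OF \<psi>(3)] have "0 \<le> H x (u x) (enn2real (slope \<psi>\<^sub>1 x) + enn2real (slope_env \<psi>\<^sub>2 x))"
      by simp
    then show ?thesis by (simp add: H_upper_eq[where H=H, OF mono[OF \<psi>(3)]])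
  qed
  ultimately show ?thesis
    using c unfolding s_solution_def s_subsolution_def s_supersolution_def by blast
qed


subsection \<open>Approximate extrema as touching points\<close>

lemma Lip_loc_lipschitz:
  assumes "open \<Omega>" "L-lipschitz_on UNIV u"
  shows "u \<in> Lip_loc \<Omega>"
  unfolding Lip_loc_def
proof (intro CollectI ballI)
  fix x assume "x \<in> \<Omega>"
  then obtain \<delta> where "\<delta> > 0" "ball x \<delta> \<subseteq> \<Omega>" using assms(1) openE by blast
  then show "\<exists>\<delta>>0. ball x \<delta> \<subseteq> \<Omega> \<and> (\<exists>L. L-lipschitz_on (ball x \<delta>) u)"
    using lipschitz_on_subset[OF assms(2)] by blast
qed

lemma lipschitz_on_cmult_dist:
  "\<bar>c\<bar>-lipschitz_on UNIV (\<lambda>w. c * dist w z)"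
proof (rule lipschitz_onI)
  fix v w
  have "\<bar>c\<bar> * \<bar>dist v z - dist w z\<bar> \<le> \<bar>c\<bar> * dist v w"
    using abs_dist_diff_le[of v z w] by (intro mult_left_mono) (auto simp: dist_commute)
  then show "dist (c * dist v z) (c * dist w z) \<le> \<bar>c\<bar> * dist v w"
    by (simp add: dist_real_def abs_mult[symmetric] right_diff_distrib)
qed simp

text \<open>Bounds the relaxation radius caused by an Ekeland perturbation used as
  \<open>\<psi>\<^sub>2\<close>.\<close>

lemma enn2real_slope_env_cmult_dist_le: "enn2real (slope_env (\<lambda>w. c * dist w z) x) \<le> \<bar>c\<bar>"
  using lipschitz_on_slope_env_le[OF lipschitz_on_cmult_dist[of c z], of x] by (intro enn2real_leI) auto

lemma s_subsolutionD:
  assumes "s_subsolution H \<Omega> u" "local_max_at (\<lambda>y. u y - \<psi>\<^sub>1 y - \<psi>\<^sub>2 y) x"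
    and "\<psi>\<^sub>1 \<in> C_under \<Omega>" "\<psi>\<^sub>2 \<in> Lip_loc \<Omega>" "x \<in> \<Omega>"
  shows "H_lower H (enn2real (slope_env \<psi>\<^sub>2 x)) x (u x) (enn2real (slope \<psi>\<^sub>1 x)) \<le> 0"
  using assms unfolding s_subsolution_def by blast

text \<open>Ekeland's principle on the closed ball, started at \<open>y\<close>, gives a point
  \<open>z\<close> where \<open>u - \<phi> (d(\<cdot>, x)) - \<eta> d(\<cdot>, z)\<close> is
  maximal. The assumption on the sphere puts \<open>z\<close> in the open ball, so this is a genuine
  local maximum, and the perturbation costs at most \<open>\<eta>\<close> in the slope.\<close>

lemma s_subsolution_test_point:
  fixes u :: "'a::complete_space \<Rightarrow> real"
  assumes len: "length_space TYPE('a)" and "open \<Omega>" and sub: "s_subsolution H \<Omega> u"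
    and mono: "\<And>x. x \<in> \<Omega> \<Longrightarrow> mono_on {0..} (H x (u x))"
    and cu: "continuous_on \<Omega> u"
    and d: "\<And>r. (\<phi> has_real_derivative \<phi>' r) (at r)" and c: "continuous_on UNIV \<phi>'"
    and nonneg: "\<forall>r\<ge>0. \<phi>' r \<ge> 0" and zero: "\<phi>' 0 = 0"
    and ball: "cball x r \<subseteq> \<Omega>" and bdd: "\<And>w. w \<in> cball x r \<Longrightarrow> u w - \<phi> (dist w x) \<le> B"
    and y: "y \<in> cball x r" and bdry: "\<And>w. dist w x = r \<Longrightarrow> u w - \<phi> r < u y - \<phi> (dist y x)"
    and \<eta>: "\<eta> > 0"
  obtains z where "z \<in> ball x r" "u y - \<phi> (dist y x) \<le> u z - \<phi> (dist z x)"
    "H z (u z) (max (\<phi>' (dist z x) - \<eta>) 0) \<le> 0"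
proof -
  have c\<phi>: "continuous_on UNIV \<phi>" using d by (meson DERIV_isCont continuous_at_imp_continuous_on)
  have cf: "continuous_on (cball x r) (\<lambda>w. u w - \<phi> (dist w x))"
    by (intro continuous_intros continuous_on_subset[OF cu ball] continuous_on_compose2[OF c\<phi>]) auto
  obtain z where z: "z \<in> cball x r" "u y - \<phi> (dist y x) \<le> u z - \<phi> (dist z x)"
    "\<And>w. w \<in> cball x r \<Longrightarrow> u w - \<phi> (dist w x) \<le> u z - \<phi> (dist z x) + \<eta> * dist w z"
    using ekeland[OF _ cf bdd y \<eta>] by (metis closed_cball complete_eq_closed)
  have "dist z x \<noteq> r" using z(2) bdry[of z] by auto
  then have zb: "z \<in> ball x r" using z(1) by (simp add: dist_commute)
  have z\<Omega>: "z \<in> \<Omega>" using z ball by auto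
  have "\<forall>\<^sub>F w in nhds z. w \<in> ball x r" using zb by (intro eventually_nhds_in_open) auto
  then have "local_max_at (\<lambda>w. u w - \<phi> (dist w x) - \<eta> * dist w z) z"
    unfolding local_max_at_def
  proof eventually_elim
    case (elim w)
    then show ?case using z(3)[of w] by simp
  qed
  then have *: "H_lower H (enn2real (slope_env (\<lambda>w. \<eta> * dist w z) z)) z (u z) (enn2real (slope (\<lambda>w. \<phi> (dist w x)) z)) \<le> 0"
    by (rule s_subsolutionD[OF sub _ radial_test_functions(1)[OF len \<open>open \<Omega>\<close> d c nonneg zero]
      Lip_loc_lipschitz[OF \<open>open \<Omega>\<close> lipschitz_on_cmult_dist] z\<Omega>])
  have sl: "enn2real (slope (\<lambda>w. \<phi> (dist w x)) z) = \<phi>' (dist z x)"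
    using nonneg by (simp add: radial_slopes[OF len d nonneg zero])
  have "H z (u z) (max (\<phi>' (dist z x) - \<eta>) 0)
      \<le> H z (u z) (max (\<phi>' (dist z x) - enn2real (slope_env (\<lambda>w. \<eta> * dist w z) z)) 0)"
    using enn2real_slope_env_cmult_dist_le[of \<eta> z z] \<eta> by (intro mono_onD[OF mono[OF z\<Omega>]]) auto
  also have "\<dots> \<le> 0"
    using * nonneg by (simp add: sl H_lower_eq[where H=H, OF mono[OF z\<Omega>]])
  finally show ?thesis using that zb z(2) by blast
qed

lemma s_supersolutionD:
  assumes "s_supersolution H \<Omega> u" "local_min_at (\<lambda>y. u y - \<psi>\<^sub>1 y - \<psi>\<^sub>2 y) x"
    and "\<psi>\<^sub>1 \<in> C_over \<Omega>" "\<psi>\<^sub>2 \<in> Lip_loc \<Omega>" "x \<in> \<Omega>"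
  shows "H_upper H (enn2real (slope_env \<psi>\<^sub>2 x)) x (u x) (enn2real (slope \<psi>\<^sub>1 x)) \<ge> 0"
  using assms unfolding s_supersolution_def by blast

text \<open>The mirror image: Ekeland's principle is applied to
  \<open>- (u + \<phi> (d(\<cdot>, x)))\<close>, and the test functions are
  \<open>- \<phi> (d(\<cdot>, x))\<close> and \<open>- \<eta> d(\<cdot>, z)\<close>.\<close>

lemma s_supersolution_test_point:
  fixes u :: "'a::complete_space \<Rightarrow> real"
  assumes len: "length_space TYPE('a)" and "open \<Omega>" and super: "s_supersolution H \<Omega> u"
    and mono: "\<And>x. x \<in> \<Omega> \<Longrightarrow> mono_on {0..} (H x (u x))"
    and cu: "continuous_on \<Omega> u"
    and d: "\<And>r. (\<phi> has_real_derivative \<phi>' r) (at r)" and c: "continuous_on UNIV \<phi>'"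
    and nonneg: "\<forall>r\<ge>0. \<phi>' r \<ge> 0" and zero: "\<phi>' 0 = 0"
    and ball: "cball x r \<subseteq> \<Omega>" and bdd: "\<And>w. w \<in> cball x r \<Longrightarrow> B \<le> u w + \<phi> (dist w x)"
    and y: "y \<in> cball x r" and bdry: "\<And>w. dist w x = r \<Longrightarrow> u y + \<phi> (dist y x) < u w + \<phi> r"
    and \<eta>: "\<eta> > 0"
  obtains z where "z \<in> ball x r" "0 \<le> H z (u z) (\<phi>' (dist z x) + \<eta>)"
proof -
  have c\<phi>: "continuous_on UNIV \<phi>" using d by (meson DERIV_isCont continuous_at_imp_continuous_on)
  have cf: "continuous_on (cball x r) (\<lambda>w. - (u w + \<phi> (dist w x)))"
    by (intro continuous_intros continuous_on_subset[OF cu ball] continuous_on_compose2[OF c\<phi>]) auto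
  have bdd': "- (u w + \<phi> (dist w x)) \<le> - B" if "w \<in> cball x r" for w using bdd[OF that] by simp
  obtain z where z: "z \<in> cball x r" "- (u y + \<phi> (dist y x)) \<le> - (u z + \<phi> (dist z x))"
    "\<And>w. w \<in> cball x r \<Longrightarrow> - (u w + \<phi> (dist w x)) \<le> - (u z + \<phi> (dist z x)) + \<eta> * dist w z"
    using ekeland[OF _ cf bdd' y \<eta>] by (metis closed_cball complete_eq_closed)
  have "dist z x \<noteq> r" using z(2) bdry[of z] by auto
  then have zb: "z \<in> ball x r" using z(1) by (simp add: dist_commute)
  have z\<Omega>: "z \<in> \<Omega>" using z ball by auto
  have "\<forall>\<^sub>F w in nhds z. w \<in> ball x r" using zb by (intro eventually_nhds_in_open) auto
  then have "local_min_at (\<lambda>w. u w - (- \<phi> (dist w x)) - (- \<eta>) * dist w z) z"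
    unfolding local_min_at_def
  proof eventually_elim
    case (elim w)
    then show ?case using z(3)[of w] by simp
  qed
  then have *: "H_upper H (enn2real (slope_env (\<lambda>w. (- \<eta>) * dist w z) z)) z (u z) (enn2real (slope (\<lambda>w. - \<phi> (dist w x)) z)) \<ge> 0"
    by (rule s_supersolutionD[OF super _ radial_test_functions(2)[OF len \<open>open \<Omega>\<close> d c nonneg zero]
      Lip_loc_lipschitz[OF \<open>open \<Omega>\<close> lipschitz_on_cmult_dist] z\<Omega>])
  have sl: "enn2real (slope (\<lambda>w. - \<phi> (dist w x)) z) = \<phi>' (dist z x)"
    using nonneg by (simp add: slope_uminus radial_slopes[OF len d nonneg zero])
  have "0 \<le> H z (u z) (\<phi>' (dist z x) + enn2real (slope_env (\<lambda>w. (- \<eta>) * dist w z) z))"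
    using * nonneg by (simp add: sl H_upper_eq[where H=H, OF mono[OF z\<Omega>]])
  also have "\<dots> \<le> H z (u z) (\<phi>' (dist z x) + \<eta>)"
    using enn2real_slope_env_cmult_dist_le[of "- \<eta>" z z] \<eta> nonneg
    by (intro mono_onD[OF mono[OF z\<Omega>]]) (auto intro: add_nonneg_nonneg)
  finally show ?thesis using that zb by blast
qed

text \<open>The cone \<open>s \<mapsto> M * s\<close> is smoothed at the vertex, where the distance function itself is not an
  admissible test function; the quadratic term makes it steep enough to keep maxima away from the
  boundary of a ball.\<close>

definition profile :: "real \<Rightarrow> real \<Rightarrow> real \<Rightarrow> real \<Rightarrow> real" where
  "profile M A e s = M * (sqrt (s\<^sup>2 + e\<^sup>2) - e) + A * s\<^sup>2"

definition profile' :: "real \<Rightarrow> real \<Rightarrow> real \<Rightarrow> real \<Rightarrow> real" where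
  "profile' M A e s = M * s / sqrt (s\<^sup>2 + e\<^sup>2) + 2 * A * s"

context
  fixes M A e :: real
  assumes MA: "0 \<le> M" "0 \<le> A" and e: "0 < e"
begin

lemma profile_sqrt_pos: "sqrt (s\<^sup>2 + e\<^sup>2) > 0"
  using e by (simp add: add_nonneg_pos)

lemma profile_sqrt_le: "0 \<le> s \<Longrightarrow> sqrt (s\<^sup>2 + e\<^sup>2) \<le> s + e"
  using e by (intro real_le_lsqrt) (auto simp: power2_sum)

lemma profile_has_derivative: "(profile M A e has_real_derivative profile' M A e s) (at s)"
proof -
  have "s\<^sup>2 + e\<^sup>2 > 0" using e by (simp add: add_nonneg_pos)
  then show ?thesis
    unfolding profile_def[abs_def] profile'_def
    by (auto intro!: derivative_eq_intros simp: field_simps)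
qed

lemma profile'_continuous: "continuous_on UNIV (profile' M A e)"
  unfolding profile'_def[abs_def]
  using profile_sqrt_pos by (intro continuous_intros) (metis less_irrefl UNIV_I)

lemma profile'_nonneg: "\<forall>s\<ge>0. 0 \<le> profile' M A e s"
  using MA unfolding profile'_def by (intro allI impI add_nonneg_nonneg) auto

lemma profile'_0: "profile' M A e 0 = 0"
  by (simp add: profile'_def)

lemma profile_0: "profile M A e 0 = 0"
  using e by (simp add: profile_def)

lemma profile_le: "0 \<le> s \<Longrightarrow> profile M A e s \<le> M * s + A * s\<^sup>2"
  using MA profile_sqrt_le[of s] by (auto simp: profile_def intro!: mult_left_mono)

text \<open>Smoothing lowers the cone by at most \<open>M * e\<close>.\<close>

lemma profile_ge: "0 \<le> s \<Longrightarrow> M * (s - e) + A * s\<^sup>2 \<le> profile M A e s"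
  using MA by (auto simp: profile_def intro!: mult_left_mono real_le_rsqrt)

text \<open>This bound does not depend on \<open>M\<close> and \<open>e\<close>, so the sphere can
  be controlled by \<open>A\<close> before the smoothing parameter is chosen.\<close>

lemma profile_ge_square: "A * s\<^sup>2 \<le> profile M A e s"
  using MA e by (auto simp: profile_def intro!: mult_nonneg_nonneg real_le_rsqrt)

text \<open>At a fixed positive distance from the vertex the steepness approaches \<open>M\<close>
  or more as \<open>e\<close> tends to 0.\<close>

lemma profile'_ge:
  assumes "0 \<le> s"
  shows "M * s / (s + e) \<le> profile' M A e s"
proof -
  have "M * s / (s + e) \<le> M * s / sqrt (s\<^sup>2 + e\<^sup>2)"
    using MA assms profile_sqrt_le[OF assms] profile_sqrt_pos[of s] e by (intro divide_left_mono) auto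
  moreover have "0 \<le> 2 * A * s" using MA assms by simp
  ultimately show ?thesis unfolding profile'_def by linarith
qed

lemma profile'_le:
  assumes "0 \<le> s"
  shows "profile' M A e s \<le> M + 2 * A * s"
proof -
  have "M * s \<le> M * sqrt (s\<^sup>2 + e\<^sup>2)" using MA by (intro mult_left_mono real_le_rsqrt) auto
  then show ?thesis
    using profile_sqrt_pos[of s] by (simp add: profile'_def divide_le_eq)
qed

end

section \<open>Closed balls on which local conditions hold throughout\<close>

lemma eventually_on_cball:
  fixes x :: "'a::metric_space"
  assumes "open \<Omega>" "x \<in> \<Omega>" "\<forall>\<^sub>F w in nhds x. P w"
  obtains r where "r > 0" "cball x r \<subseteq> \<Omega>" "\<And>w. w \<in> cball x r \<Longrightarrow> P w"
proof -
  have "\<forall>\<^sub>F w in nhds x. w \<in> \<Omega> \<and> P w"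
    using assms eventually_nhds_in_open[OF assms(1,2)] by (simp add: eventually_conj)
  then obtain r where "r > 0" "\<And>w. dist w x \<le> r \<Longrightarrow> w \<in> \<Omega> \<and> P w"
    unfolding eventually_nhds_metric_le by auto
  then show ?thesis using that[of r] by (auto simp: dist_commute subset_iff)
qed

lemma continuous_on_open_eventually_bounded:
  fixes u :: "'a::metric_space \<Rightarrow> real"
  assumes "open \<Omega>" "x \<in> \<Omega>" "continuous_on \<Omega> u"
  shows "\<forall>\<^sub>F w in nhds x. \<bar>u w\<bar> \<le> \<bar>u x\<bar> + 1"
proof -
  have "(u \<longlongrightarrow> u x) (nhds x)"
    using assms continuous_on_eq_continuous_at isCont_def tendsto_at_iff_tendsto_nhds by metis
  from tendstoD[OF this, of 1] show ?thesis by (auto elim!: eventually_mono simp: dist_real_def)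
qed

lemma continuous_on_open_eventually_pos:
  fixes f :: "'a::metric_space \<Rightarrow> real"
  assumes "open \<Omega>" "x \<in> \<Omega>" "continuous_on \<Omega> f" "f x > 0"
  shows "\<forall>\<^sub>F w in nhds x. f w > 0"
proof -
  have "(f \<longlongrightarrow> f x) (nhds x)"
    using assms continuous_on_eq_continuous_at isCont_def tendsto_at_iff_tendsto_nhds by metis
  from order_tendstoD(1)[OF this assms(4)] show ?thesis .
qed

subsection \<open>s-solutions are Monge solutions\<close>

context
  fixes \<Omega> :: "'a::complete_space set" and H :: "'a \<Rightarrow> real \<Rightarrow> real \<Rightarrow> real" and u :: "'a \<Rightarrow> real"
  assumes len: "length_space TYPE('a)" and op: "open \<Omega>"
    and mono: "\<And>x. x \<in> \<Omega> \<Longrightarrow> mono_on {0..} (H x (u x))"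
    and cH: "\<And>q. q \<ge> 0 \<Longrightarrow> continuous_on \<Omega> (\<lambda>z. H z (u z) q)"
    and cu: "continuous_on \<Omega> u"
begin

text \<open>If the estimate fails for \<open>x\<close> and \<open>y\<close>, the test point
  \<open>z\<close> has \<open>u z\<close> above \<open>u x\<close> by the excess, so continuity
  keeps \<open>z\<close> away from the vertex \<open>x\<close>. There the smoothed cone is steeper
  than \<open>K\<close> even after the Ekeland loss, contradicting
  \<open>H z (u z) K > 0\<close>.\<close>

lemma s_subsolution_growth:
  assumes sub: "s_subsolution H \<Omega> u" and x0: "x\<^sub>0 \<in> \<Omega>"
    and K: "0 \<le> K" "K < M" "H x\<^sub>0 (u x\<^sub>0) K > 0"
  shows "\<exists>r>0. \<exists>A\<ge>0. ball x\<^sub>0 r \<subseteq> \<Omega> \<and>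
    (\<forall>x y. dist x x\<^sub>0 < r \<longrightarrow> dist y x < r \<longrightarrow> u y \<le> u x + M * dist y x + A * (dist y x)\<^sup>2)"
proof -
  define B where "B = \<bar>u x\<^sub>0\<bar> + 1"
  have "\<forall>\<^sub>F w in nhds x\<^sub>0. \<bar>u w\<bar> \<le> B \<and> H w (u w) K > 0"
    unfolding B_def
    by (intro eventually_conj continuous_on_open_eventually_bounded[OF op x0 cu]
      continuous_on_open_eventually_pos[OF op x0 cH] K)
  from eventually_on_cball[OF op x0 this] obtain r0 where r0: "r0 > 0" "cball x\<^sub>0 r0 \<subseteq> \<Omega>"
    "\<And>w. w \<in> cball x\<^sub>0 r0 \<Longrightarrow> \<bar>u w\<bar> \<le> B \<and> H w (u w) K > 0" by metis
  define r where "r = r0 / 2"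
  \<comment> \<open>\<open>A * r\<^sup>2\<close> exceeds the oscillation bound \<open>2 * B\<close>
    of \<open>u\<close>, so no point of the sphere competes with \<open>y\<close>. Neither
    \<open>A\<close> nor \<open>r\<close> depends on the centre \<open>x\<close>.\<close>
  define A where "A = (2 * B + 1) / r\<^sup>2"
  have r: "r > 0" and A: "A \<ge> 0" and Ar: "A * r\<^sup>2 = 2 * B + 1"
    using r0 by (auto simp: r_def A_def B_def)
  have "u y \<le> u x + M * dist y x + A * (dist y x)\<^sup>2" if x: "dist x x\<^sub>0 < r" and y: "dist y x < r" for x y
  proof (rule ccontr)
    assume "\<not> ?thesis"
    then have e: "0 < u y - (u x + M * dist y x + A * (dist y x)\<^sup>2)" (is "0 < ?e") by simp
    have sb: "cball x r \<subseteq> cball x\<^sub>0 r0"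
    proof
      fix w assume "w \<in> cball x r"
      then show "w \<in> cball x\<^sub>0 r0"
        using x dist_triangle[of x\<^sub>0 w x] by (simp add: r_def dist_commute)
    qed
    then have sO: "cball x r \<subseteq> \<Omega>" using r0(2) by (rule subset_trans)
    then have xO: "x \<in> \<Omega>" using r by (simp add: subset_iff)
    have "(u \<longlongrightarrow> u x) (nhds x)"
      using cu op xO continuous_on_eq_continuous_at isCont_def tendsto_at_iff_tendsto_nhds by metis
    from tendstoD[OF this e] obtain \<tau> where \<tau>: "\<tau> > 0" "\<And>z. dist z x < \<tau> \<Longrightarrow> dist (u z) (u x) < ?e"
      unfolding eventually_nhds_metric by auto
    \<comment> \<open>The solution of
      \<open>M * \<tau> / (\<tau> + \<epsilon>) = (M + K) / 2\<close>: from distance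
      \<open>\<tau>\<close> on, the cone has slope at least \<open>K + (M - K) / 2\<close>, and the
      remaining \<open>(M - K) / 2\<close> is spent on the Ekeland perturbation.\<close>
    define \<epsilon> where "\<epsilon> = (M - K) * \<tau> / (M + K)"
    have \<epsilon>: "\<epsilon> > 0" "(M + K) * \<epsilon> = (M - K) * \<tau>" using K \<tau> by (auto simp: \<epsilon>_def)
    have M: "M \<ge> 0" using K by simp
    note pr = profile_has_derivative[OF M A \<epsilon>(1)] profile'_continuous[OF M A \<epsilon>(1)]
      profile'_nonneg[OF M A \<epsilon>(1)] profile'_0[OF M A \<epsilon>(1)]
    have ge: "u x + ?e \<le> u y - profile M A \<epsilon> (dist y x)"
      using profile_le[OF M A \<epsilon>(1), of "dist y x"] by simp
    have pos: "0 \<le> profile M A \<epsilon> s" for s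
      using profile_ge_square[OF M A \<epsilon>(1), of s] A by (smt (verit) mult_nonneg_nonneg zero_le_power2)
    have bdd: "u w - profile M A \<epsilon> (dist w x) \<le> B" if "w \<in> cball x r" for w
      using r0(3)[of w] sb that pos[of "dist w x"] by force
    have bdry: "u w - profile M A \<epsilon> r < u y - profile M A \<epsilon> (dist y x)" if "dist w x = r" for w
    proof -
      have "w \<in> cball x r" "x \<in> cball x r" using that r by (auto simp: dist_commute)
      then have "\<bar>u w\<bar> \<le> B" "\<bar>u x\<bar> \<le> B" using sb r0(3) by blast+
      then show ?thesis using profile_ge_square[OF M A \<epsilon>(1), of r] Ar ge e by linarith
    qed
    have y': "y \<in> cball x r" using y by (simp add: dist_commute)
    have \<eta>: "0 < (M - K) / 2" using K by simp
    obtain z where z: "z \<in> ball x r" "u y - profile M A \<epsilon> (dist y x) \<le> u z - profile M A \<epsilon> (dist z x)"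
      "H z (u z) (max (profile' M A \<epsilon> (dist z x) - (M - K) / 2) 0) \<le> 0"
      using s_subsolution_test_point[OF len op sub mono cu pr sO bdd y' bdry \<eta>] by blast
    have "u x + ?e \<le> u z" using ge z(2) pos[of "dist z x"] by linarith
    then have far: "\<tau> \<le> dist z x" using \<tau>(2)[of z] by (fastforce simp: dist_real_def)
    then have "(M - K) * \<tau> \<le> (M - K) * dist z x" using K by (intro mult_left_mono) auto
    then have "K + (M - K) / 2 \<le> M * dist z x / (dist z x + \<epsilon>)"
      using \<epsilon> \<tau> far by (simp add: field_simps)
    then have "K \<le> max (profile' M A \<epsilon> (dist z x) - (M - K) / 2) 0"
      using profile'_ge[OF M A \<epsilon>(1), of "dist z x"] by simp
    moreover have zc: "z \<in> cball x r" using z(1) by auto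
    ultimately have "H z (u z) K \<le> 0"
      using mono_onD[OF mono, of z K] K z(3) sO by force
    then show False using r0(3)[of z] sb zc by force
  qed
  moreover have "ball x\<^sub>0 r \<subseteq> \<Omega>" using r0 by (force simp: r_def)
  ultimately show ?thesis using r A by blast
qed

text \<open>Settles the case of vanishing subslope, where no smaller slope is left for a
  contradiction. The test uses a pure paraboloid; whatever its slope at the test point, monotonicity
  lowers the argument of \<open>H\<close> to 0.\<close>

lemma s_subsolution_at_0:
  assumes sub: "s_subsolution H \<Omega> u" and x0: "x\<^sub>0 \<in> \<Omega>"
  shows "H x\<^sub>0 (u x\<^sub>0) 0 \<le> 0"
proof (rule ccontr)
  assume "\<not> ?thesis"
  then have n: "H x\<^sub>0 (u x\<^sub>0) 0 > 0" by simp
  define B where "B = \<bar>u x\<^sub>0\<bar> + 1"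
  have "\<forall>\<^sub>F w in nhds x\<^sub>0. \<bar>u w\<bar> \<le> B \<and> H w (u w) 0 > 0"
    unfolding B_def
    by (intro eventually_conj continuous_on_open_eventually_bounded[OF op x0 cu]
      continuous_on_open_eventually_pos[OF op x0 cH] n) auto
  from eventually_on_cball[OF op x0 this] obtain r where r: "r > 0" "cball x\<^sub>0 r \<subseteq> \<Omega>"
    "\<And>w. w \<in> cball x\<^sub>0 r \<Longrightarrow> \<bar>u w\<bar> \<le> B \<and> H w (u w) 0 > 0" by metis
  define A where "A = (2 * B + 1) / r\<^sup>2"
  have A: "A \<ge> 0" and Ar: "A * r\<^sup>2 = 2 * B + 1"
    using r by (auto simp: A_def B_def)
  \<comment> \<open>With \<open>M = 0\<close> the profile is \<open>A * s\<^sup>2\<close> for every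
    smoothing parameter; 1 is an arbitrary positive choice.\<close>
  note a = order_refl[of "0::real"] A zero_less_one[where 'a=real]
  note pr = profile_has_derivative[OF a] profile'_continuous[OF a] profile'_nonneg[OF a] profile'_0[OF a]
  have pos: "0 \<le> profile 0 A 1 s" for s
    using profile_ge_square[OF a, of s] A by (smt (verit) mult_nonneg_nonneg zero_le_power2)
  have bdd: "u w - profile 0 A 1 (dist w x\<^sub>0) \<le> B" if "w \<in> cball x\<^sub>0 r" for w
    using r(3)[OF that] pos[of "dist w x\<^sub>0"] by force
  have bdry: "u w - profile 0 A 1 r < u x\<^sub>0 - profile 0 A 1 (dist x\<^sub>0 x\<^sub>0)" if "dist w x\<^sub>0 = r" for w
    using profile_ge_square[OF a, of r] Ar r(1) r(3)[of w] r(3)[of x\<^sub>0] that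
    by (auto simp: profile_0[OF a] dist_commute)
  have x0c: "x\<^sub>0 \<in> cball x\<^sub>0 r" using r by simp
  obtain z where z: "z \<in> ball x\<^sub>0 r" "H z (u z) (max (profile' 0 A 1 (dist z x\<^sub>0) - 1) 0) \<le> 0"
    using s_subsolution_test_point[OF len op sub mono cu pr r(2) bdd x0c bdry zero_less_one] by blast
  then have zc: "z \<in> cball x\<^sub>0 r" by auto
  then have "H z (u z) 0 \<le> 0"
    using mono_onD[OF mono, of z 0 "max (profile' 0 A 1 (dist z x\<^sub>0) - 1) 0"] z(2) r(2) by force
  then show False using r(3)[OF zc] by simp
qed

text \<open>The growth estimate is uniform in the vertex, so it can be read with vertex
  \<open>x\<close> near \<open>x\<^sub>0\<close> and evaluated at \<open>x\<^sub>0\<close>; this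
  bounds the decrease of \<open>u\<close> away from \<open>x\<^sub>0\<close>.\<close>

lemma s_subsolution_sub_slope_le:
  assumes sub: "s_subsolution H \<Omega> u" and x0: "x\<^sub>0 \<in> \<Omega>" and K: "0 \<le> K" "H x\<^sub>0 (u x\<^sub>0) K > 0"
  shows "sub_slope u x\<^sub>0 \<le> ennreal K"
proof (rule ennreal_le_epsilon)
  fix e :: real assume e: "e > 0"
  have "K < K + e/2" using e by simp
  obtain r A where rA: "r > 0" "A \<ge> 0" "ball x\<^sub>0 r \<subseteq> \<Omega>"
    "\<And>x y. dist x x\<^sub>0 < r \<Longrightarrow> dist y x < r \<Longrightarrow> u y \<le> u x + (K + e/2) * dist y x + A * (dist y x)\<^sup>2"
    using s_subsolution_growth[OF sub x0 K(1) \<open>K < K + e/2\<close> K(2)] by blast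
  \<comment> \<open>Makes the quadratic term at most \<open>e / 2\<close> times the distance;
    \<open>A + 1\<close> keeps the denominator positive when \<open>A = 0\<close>.\<close>
  define \<delta> where "\<delta> = min r (e / (2 * (A + 1)))"
  have \<delta>: "\<delta> > 0" "\<delta> \<le> r" "\<delta> \<le> e / (2 * (A + 1))" using rA e by (auto simp: \<delta>_def)
  have "u x\<^sub>0 - u x \<le> (K + e) * dist x\<^sub>0 x" if "dist x x\<^sub>0 < \<delta>" for x
  proof -
    have "(A + 1) * dist x\<^sub>0 x \<le> (A + 1) * (e / (2 * (A + 1)))"
      using that rA(2) \<delta>(3) by (intro mult_left_mono) (auto simp: dist_commute)
    also have "\<dots> = e / 2" using rA(2) by (simp add: field_simps)
    finally have "A * dist x\<^sub>0 x \<le> e / 2" using zero_le_dist[of x\<^sub>0 x] unfolding distrib_right by linarith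
    then have "A * dist x\<^sub>0 x * dist x\<^sub>0 x \<le> e / 2 * dist x\<^sub>0 x" by (intro mult_right_mono) auto
    moreover have "u x\<^sub>0 \<le> u x + (K + e/2) * dist x\<^sub>0 x + A * (dist x\<^sub>0 x)\<^sup>2"
      using that \<delta> by (intro rA(4)) (auto simp: dist_commute)
    ultimately show ?thesis by (simp add: power2_eq_square algebra_simps)
  qed
  then have "sub_slope u x\<^sub>0 \<le> ennreal (K + e)"
    using K e \<delta> by (intro sub_slope_leI) (auto simp: eventually_at)
  then show "sub_slope u x\<^sub>0 \<le> ennreal K + ennreal e" using K e by simp
qed

text \<open>Two points of the ball of radius \<open>r/2\<close> are less than \<open>r\<close>
  apart, so the growth estimate applies with either one as vertex.\<close>

lemma s_subsolution_Lip_loc: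
  assumes sub: "s_subsolution H \<Omega> u"
    and coercive: "\<And>x. x \<in> \<Omega> \<Longrightarrow> \<exists>K\<ge>0. H x (u x) K > 0"
  shows "u \<in> Lip_loc \<Omega>"
  unfolding Lip_loc_def
proof (intro CollectI ballI)
  fix x\<^sub>0 assume x0: "x\<^sub>0 \<in> \<Omega>"
  obtain K where K: "0 \<le> K" "H x\<^sub>0 (u x\<^sub>0) K > 0" using coercive[OF x0] by blast
  have "K < K + 1" by simp
  obtain r A where rA: "r > 0" "A \<ge> 0" "ball x\<^sub>0 r \<subseteq> \<Omega>"
    "\<And>x y. dist x x\<^sub>0 < r \<Longrightarrow> dist y x < r \<Longrightarrow> u y \<le> u x + (K + 1) * dist y x + A * (dist y x)\<^sup>2"
    using s_subsolution_growth[OF sub x0 K(1) \<open>K < K + 1\<close> K(2)] by blast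
  have le: "u y - u x \<le> (K + 1 + A * r) * dist y x" if "x \<in> ball x\<^sub>0 (r/2)" "y \<in> ball x\<^sub>0 (r/2)" for x y
  proof -
    have yx: "dist y x < r" using that dist_triangle[of y x x\<^sub>0] by (auto simp: dist_commute)
    have "A * dist y x * dist y x \<le> A * r * dist y x"
      using yx rA by (intro mult_right_mono mult_left_mono) auto
    moreover have "u y \<le> u x + (K + 1) * dist y x + A * (dist y x)\<^sup>2"
      using that yx rA(1) by (intro rA(4)) (auto simp: dist_commute)
    ultimately show ?thesis by (simp add: power2_eq_square algebra_simps)
  qed
  have "(K + 1 + A * r)-lipschitz_on (ball x\<^sub>0 (r/2)) u"
  proof (rule lipschitz_onI)
    fix x y assume "x \<in> ball x\<^sub>0 (r/2)" "y \<in> ball x\<^sub>0 (r/2)"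
    then show "dist (u x) (u y) \<le> (K + 1 + A * r) * dist x y"
      using le[of x y] le[of y x] by (simp add: dist_real_def abs_le_iff dist_commute)
  qed (use K rA in auto)
  moreover have "ball x\<^sub>0 (r/2) \<subseteq> \<Omega>" using rA subset_ball[of "r/2" r x\<^sub>0] by auto
  moreover have "r/2 > 0" using rA by simp
  ultimately show "\<exists>\<delta>>0. ball x\<^sub>0 \<delta> \<subseteq> \<Omega> \<and> (\<exists>L. L-lipschitz_on (ball x\<^sub>0 \<delta>) u)" by blast
qed

text \<open>If the subslope were smaller, \<open>u\<close> plus a smoothed cone of slope
  \<open>k1 < k\<close> would be larger on a small sphere than at \<open>x\<^sub>0\<close>. The
  resulting test point sees a total slope of at most \<open>k\<close>, where \<open>H\<close> is
  still negative.\<close>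

lemma s_supersolution_sub_slope_ge:
  assumes super: "s_supersolution H \<Omega> u" and x0: "x\<^sub>0 \<in> \<Omega>"
    and k: "0 \<le> k" "H x\<^sub>0 (u x\<^sub>0) k < 0"
  shows "ennreal k \<le> sub_slope u x\<^sub>0"
proof (rule ccontr)
  assume "\<not> ?thesis"
  then have less: "sub_slope u x\<^sub>0 < ennreal k" by simp
  then obtain p where p: "sub_slope u x\<^sub>0 = ennreal p" "0 \<le> p"
    by (cases "sub_slope u x\<^sub>0") auto
  have pk: "p < k" using less p by (simp add: ennreal_less_iff)
  \<comment> \<open>Of the levels \<open>p < k2 < k1 < k\<close>, \<open>k2\<close> bounds the
    decrease of \<open>u\<close>, \<open>k1\<close> is the slope of the cone, and
    \<open>k - k1\<close> is the Ekeland allowance.\<close>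
  define k1 where "k1 = (p + k) / 2"
  define k2 where "k2 = (p + k1) / 2"
  have ks: "p < k2" "k2 < k1" "k1 < k" "0 < k1" using pk p by (auto simp: k1_def k2_def)
  define B where "B = \<bar>u x\<^sub>0\<bar> + 1"
  have "sub_slope u x\<^sub>0 < ennreal k2" using p ks by (simp add: ennreal_less_iff)
  from sub_slope_lessD[OF this] have ev: "\<forall>\<^sub>F w in nhds x\<^sub>0. u x\<^sub>0 - u w \<le> k2 * dist x\<^sub>0 w"
    unfolding eventually_at_filter by (auto elim!: eventually_mono)
  have "\<forall>\<^sub>F w in nhds x\<^sub>0. \<bar>u w\<bar> \<le> B \<and> - H w (u w) k > 0 \<and> u x\<^sub>0 - u w \<le> k2 * dist x\<^sub>0 w"
    unfolding B_def
    by (intro eventually_conj continuous_on_open_eventually_bounded[OF op x0 cu] ev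
      continuous_on_open_eventually_pos[OF op x0] continuous_on_minus cH k) (use k in simp)
  from eventually_on_cball[OF op x0 this] obtain r where r: "r > 0" "cball x\<^sub>0 r \<subseteq> \<Omega>"
    "\<And>w. w \<in> cball x\<^sub>0 r \<Longrightarrow> \<bar>u w\<bar> \<le> B \<and> - H w (u w) k > 0 \<and> u x\<^sub>0 - u w \<le> k2 * dist x\<^sub>0 w" by metis
  \<comment> \<open>The smoothing loss \<open>k1 * \<epsilon>\<close> is half of the gain
    \<open>(k1 - k2) * r\<close> of the cone over \<open>u\<close> on the sphere; no quadratic term
    is added.\<close>
  define \<epsilon> where "\<epsilon> = (k1 - k2) * r / (2 * k1)"
  have \<epsilon>: "\<epsilon> > 0" "k1 * \<epsilon> < k1 * r - k2 * r" using ks r by (auto simp: \<epsilon>_def field_simps)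
  note a = less_imp_le[OF ks(4)] order_refl[of "0::real"] \<epsilon>(1)
  note pr = profile_has_derivative[OF a] profile'_continuous[OF a] profile'_nonneg[OF a] profile'_0[OF a]
  have bdd: "- B \<le> u w + profile k1 0 \<epsilon> (dist w x\<^sub>0)" if "w \<in> cball x\<^sub>0 r" for w
    using r(3)[OF that] profile_ge_square[OF a, of "dist w x\<^sub>0"] by force
  have bdry: "u x\<^sub>0 + profile k1 0 \<epsilon> (dist x\<^sub>0 x\<^sub>0) < u w + profile k1 0 \<epsilon> r" if "dist w x\<^sub>0 = r" for w
    using that r(3)[of w] profile_ge[OF a, of r] \<epsilon>(2) r(1)
    by (simp add: profile_0[OF a] dist_commute right_diff_distrib)
  have x0c: "x\<^sub>0 \<in> cball x\<^sub>0 r" and \<eta>: "0 < k - k1" using r ks by auto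
  obtain z where z: "z \<in> ball x\<^sub>0 r" "0 \<le> H z (u z) (profile' k1 0 \<epsilon> (dist z x\<^sub>0) + (k - k1))"
    by (rule s_supersolution_test_point[OF len op super mono cu pr r(2) bdd x0c bdry \<eta>])
  then have zc: "z \<in> cball x\<^sub>0 r" by auto
  then have "H z (u z) (profile' k1 0 \<epsilon> (dist z x\<^sub>0) + (k - k1)) \<le> H z (u z) k"
    using profile'_le[OF a, of "dist z x\<^sub>0"] profile'_nonneg[OF a] ks r(2)
    by (intro mono_onD[OF mono]) auto
  then show False using z(2) r(3)[OF zc] by simp
qed

text \<open>A nonzero value of \<open>H\<close> at the subslope \<open>p\<close> persists for nearby
  arguments: a positive one just below \<open>p\<close> forces the subslope below \<open>p\<close>,
  a negative one just above \<open>p\<close> forces it above \<open>p\<close>.\<close>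

lemma s_solution_imp_Monge_solution:
  assumes s: "s_solution H \<Omega> u"
    and cq: "\<And>x. x \<in> \<Omega> \<Longrightarrow> continuous_on {0..} (H x (u x))"
    and coercive: "\<And>x. x \<in> \<Omega> \<Longrightarrow> \<exists>K\<ge>0. H x (u x) K > 0"
  shows "Monge_solution H \<Omega> u"
proof -
  have sub: "s_subsolution H \<Omega> u" and super: "s_supersolution H \<Omega> u"
    using s by (auto simp: s_solution_def)
  have Lip: "u \<in> Lip_loc \<Omega>" by (rule s_subsolution_Lip_loc[OF sub coercive])
  have "H x (u x) (enn2real (sub_slope u x)) = 0" if x: "x \<in> \<Omega>" for x
  proof -
    define p where "p = enn2real (sub_slope u x)"
    have p: "sub_slope u x = ennreal p" "p \<ge> 0"
      using Lip_loc_sub_slope_finite[OF Lip x] by (auto simp: p_def)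
    have t: "(H x (u x) \<longlongrightarrow> H x (u x) p) (at p within {0..})"
      using cq[OF x] p by (simp add: continuous_on_def)
    have "H x (u x) p \<le> 0"
    proof (rule ccontr)
      assume "\<not> ?thesis"
      then have n: "0 < H x (u x) p" by simp
      then have "p \<noteq> 0" using s_subsolution_at_0[OF sub x] by auto
      then have p0: "p > 0" using p by simp
      from order_tendstoD(1)[OF t n] obtain d where d: "d > 0"
        "\<And>q. q \<ge> 0 \<Longrightarrow> q \<noteq> p \<Longrightarrow> dist q p < d \<Longrightarrow> 0 < H x (u x) q" unfolding eventually_at by auto
      \<comment> \<open>Within \<open>d\<close> of \<open>p\<close> and strictly below it; the bound
        \<open>p / 2\<close> keeps \<open>q\<close> nonnegative.\<close>
      define q where "q = max (p / 2) (p - d / 2)"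
      have q: "0 \<le> q" "q < p" "dist q p < d" using p0 d by (auto simp: q_def dist_real_def)
      have "sub_slope u x \<le> ennreal q"
        using q d(2)[of q] by (intro s_subsolution_sub_slope_le[OF sub x]) auto
      then show False using p q by simp
    qed
    moreover have "0 \<le> H x (u x) p"
    proof (rule ccontr)
      assume "\<not> ?thesis"
      then have n: "H x (u x) p < 0" by simp
      from order_tendstoD(2)[OF t n] obtain d where d: "d > 0"
        "\<And>q. q \<ge> 0 \<Longrightarrow> q \<noteq> p \<Longrightarrow> dist q p < d \<Longrightarrow> H x (u x) q < 0" unfolding eventually_at by auto
      have "ennreal (p + d / 2) \<le> sub_slope u x"
        using p d by (intro s_supersolution_sub_slope_ge[OF super x] d(2)) (auto simp: dist_real_def)
      then show False using p d by simp
    qed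
    ultimately show ?thesis by (simp add: p_def)
  qed
  with Lip show ?thesis by (simp add: Monge_solution_def)
qed

end

theorem theorem4p11:
  fixes \<Omega> :: "'a::complete_space set"
    and H :: "'a \<Rightarrow> real \<Rightarrow> real \<Rightarrow> real"
    and u :: "'a \<Rightarrow> real"
  assumes "length_space TYPE('a)"
    and "open \<Omega>"
    and "continuous_on (\<Omega> \<times> UNIV \<times> {0..}) (\<lambda>(x, \<rho>, p). H x \<rho> p)"
    and "\<And>x\<^sub>0 \<rho>\<^sub>0. x\<^sub>0 \<in> \<Omega> \<Longrightarrow>
           \<exists>\<delta>>0. \<exists>\<omega>. ball x\<^sub>0 \<delta> \<subseteq> \<Omega> \<and> modulus_of_continuity \<omega> \<and>
             (\<forall>x\<^sub>1\<in>ball x\<^sub>0 \<delta>. \<forall>x\<^sub>2\<in>ball x\<^sub>0 \<delta>. \<forall>\<rho>\<^sub>1\<in>{\<rho>\<^sub>0 - \<delta>..\<rho>\<^sub>0 + \<delta>}. \<forall>\<rho>\<^sub>2\<in>{\<rho>\<^sub>0 - \<delta>..\<rho>\<^sub>0 + \<delta>}. \<forall>p\<ge>0.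
                \<bar>H x\<^sub>1 \<rho>\<^sub>1 p - H x\<^sub>2 \<rho>\<^sub>2 p\<bar> \<le> \<omega> (dist x\<^sub>1 x\<^sub>2 + \<bar>\<rho>\<^sub>1 - \<rho>\<^sub>2\<bar>))"
    and "\<And>x\<^sub>0 \<rho>\<^sub>0. x\<^sub>0 \<in> \<Omega> \<Longrightarrow>
           \<exists>\<delta>>0. \<exists>l\<^sub>0>0. ball x\<^sub>0 \<delta> \<subseteq> \<Omega> \<and>
             (\<forall>x\<in>ball x\<^sub>0 \<delta>. \<forall>\<rho>\<in>{\<rho>\<^sub>0 - \<delta>..\<rho>\<^sub>0 + \<delta>}. mono_on {0..} (\<lambda>p. H x \<rho> p - l\<^sub>0 * p))"
    and "\<And>R. R > 0 \<Longrightarrow>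
           ((\<lambda>p. INF (x, \<rho>) \<in> \<Omega> \<times> {-R..R}. ereal (H x \<rho> p)) \<longlongrightarrow> \<infinity>) at_top"
  shows "(Monge_solution H \<Omega> u \<longleftrightarrow> locally_uniformly_continuous_on \<Omega> u \<and> s_solution H \<Omega> u) \<and>
         (locally_uniformly_continuous_on \<Omega> u \<and> s_solution H \<Omega> u \<longrightarrow> u \<in> Lip_loc \<Omega>)"
proof -
  have incr: "\<exists>l>0. \<forall>p q. 0 \<le> p \<longrightarrow> p \<le> q \<longrightarrow> H x (u x) p + l * (q - p) \<le> H x (u x) q" if x: "x \<in> \<Omega>" for x
  proof -
    obtain \<delta> l where "\<delta> > 0" "l > 0"
      "\<forall>y\<in>ball x \<delta>. \<forall>\<rho>\<in>{u x - \<delta>..u x + \<delta>}. mono_on {0..} (\<lambda>p. H y \<rho> p - l * p)"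
      using assms(5)[OF x, of "u x"] by blast
    then have "l > 0" and m: "mono_on {0..} (\<lambda>p. H x (u x) p - l * p)" by auto
    have "H x (u x) p + l * (q - p) \<le> H x (u x) q" if "0 \<le> p" "p \<le> q" for p q
      using mono_onD[OF m, of p q] that by (simp add: algebra_simps)
    with \<open>l > 0\<close> show ?thesis by blast
  qed
  have mono: "mono_on {0..} (H x (u x))" if x: "x \<in> \<Omega>" for x
  proof (rule mono_onI)
    fix p q :: real assume pq: "p \<in> {0..}" "p \<le> q"
    obtain l where l: "l > 0" "\<And>p q. 0 \<le> p \<Longrightarrow> p \<le> q \<Longrightarrow> H x (u x) p + l * (q - p) \<le> H x (u x) q"
      using incr[OF x] by blast
    have "0 \<le> l * (q - p)" using l(1) pq by simp
    then show "H x (u x) p \<le> H x (u x) q" using l(2)[of p q] pq by simp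
  qed
  have coercive: "\<exists>K\<ge>0. H x (u x) K > 0" if x: "x \<in> \<Omega>" for x
  proof -
    obtain l where l: "l > 0" "\<And>p q. 0 \<le> p \<Longrightarrow> p \<le> q \<Longrightarrow> H x (u x) p + l * (q - p) \<le> H x (u x) q"
      using incr[OF x] by blast
    \<comment> \<open>Growth at rate \<open>l\<close> from the value at 0 gives
      \<open>H x (u x) K \<ge> H x (u x) 0 + \<bar>H x (u x) 0\<bar> + 1\<close>, which is
      positive.\<close>
    define K where "K = (\<bar>H x (u x) 0\<bar> + 1) / l"
    have "K \<ge> 0" "l * K = \<bar>H x (u x) 0\<bar> + 1" using l(1) by (auto simp: K_def)
    then show ?thesis using l(2)[of 0 K] by (intro exI[of _ K]) auto
  qed
  have cH: "continuous_on \<Omega> (\<lambda>z. H z (u z) q)" if "q \<ge> 0" "continuous_on \<Omega> u" for q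
  proof -
    have "continuous_on \<Omega> (\<lambda>z. (\<lambda>(x, \<rho>, p). H x \<rho> p) (z, u z, q))"
      by (rule continuous_on_compose2[OF assms(3)]) (use that in \<open>auto intro!: continuous_intros\<close>)
    then show ?thesis by simp
  qed
  have cq: "continuous_on {0..} (H x (u x))" if "x \<in> \<Omega>" for x
  proof -
    have "continuous_on {0..} (\<lambda>q. (\<lambda>(x, \<rho>, p). H x \<rho> p) (x, u x, q))"
      by (rule continuous_on_compose2[OF assms(3)]) (use that in \<open>auto intro!: continuous_intros\<close>)
    then show ?thesis by simp
  qed
  have "Monge_solution H \<Omega> u" if "s_solution H \<Omega> u"
  proof -
    have cu: "continuous_on \<Omega> u" using that by (simp add: s_solution_def)
    show ?thesis
      by (rule s_solution_imp_Monge_solution[where H=H and u=u,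
        OF assms(1,2) mono cH[OF _ cu] cu that cq coercive])
  qed
  moreover have "s_solution H \<Omega> u" if "Monge_solution H \<Omega> u"
    using Monge_solution_imp_s_solution[OF mono that] .
  moreover have "u \<in> Lip_loc \<Omega>" if "Monge_solution H \<Omega> u"
    using that by (simp add: Monge_solution_def)
  ultimately show ?thesis using Lip_loc_imp_locally_uniformly_continuous_on by blast
qed

end
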